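(* Let $(M,\varphi,\xi,\eta,g)$ be a $(2n+1)$-dimensional Sasaki-like almost contact B-metric manifold with associated B-metric $\tilde g$ and Levi-Civita connection $\nabla$ of $g$. Suppose that it admits a Ricci-like soliton with arbitrary potential vector field $v$ and constants $(\lambda,\mu,\nu)$, i.e. $v$ is a vector field on $M$ and $\lambda,\mu,\nu$ are real constants with $$\tfrac12\mathcal{L}_v g+\rho+\lambda\, g+\mu\,\tilde g+\nu\,\eta\otimes\eta=0 .$$ Then the following identities hold: $$\lambda+\mu+\nu=-2n,\qquad \nabla_\xi v=-\varphi v .$$
   Context: An almost contact B-metric manifold $(M,\varphi,\xi,\eta,g)$ is a differentiable manifold $M$ of dimension $2n+1$ with an endomorphism $\varphi$ of $TM$, a vector field $\xi$ (Reeb vector field), a 1-form $\eta$ and a pseudo-Riemannian metric $g$ of signature $(n+1,n)$ such that $\varphi\xi=0$, $\varphi^2=-\mathrm{id}+\eta\otimes\xi$, $\eta\circ\varphi=0$, $\eta(\xi)=1$ and $g(\varphi x,\varphi y)=-g(x,y)+\eta(x)\eta(y)$ for all vector fields $x,y$. The associated B-metric is $\tilde g(x,y)=g(x,\varphi y)+\eta(x)\eta(y)$. The manifold is called Sasaki-like if, with $\nabla$ the Levi-Civita connection of $g$, $(\nabla_x\varphi)y=-g(x,y)\xi-\eta(y)x+2\eta(x)\eta(y)\xi$ for all $x,y$. The curvature tensor is $R(x,y)z=\nabla_x\nabla_y z-\nabla_y\nabla_x z-\nabla_{[x,y]}z$, $R(x,y,z,w)=g(R(x,y)z,w)$, and the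 Ricci tensor of $g$ is $\rho(y,z)=g^{ij}R(e_i,y,z,e_j)$ for any local basis $\{e_i\}$. $\mathcal{L}$ denotes the Lie derivative. *)

theory Defs
  imports "HOL-Analysis.Analysis" "HOL-Library.Function_Algebras"
begin

text \<open>
  Function spaces carry the pointwise operations of \<open>Function_Algebras\<close>: for
  \<open>f g :: 'a \<Rightarrow> real\<close>, \<open>f * g\<close> is the product in the ring of functions, and tangent vectors and
  vector fields (curried functions with values in \<^typ>\<open>real\<close>) are added and subtracted pointwise.
\<close>

section \<open>Smooth manifolds\<close>

text \<open>Both notions are used on open sets only.\<close>

primrec times_differentiable_on ::
    "nat \<Rightarrow> ('b::real_normed_vector \<Rightarrow> 'c::real_normed_vector) \<Rightarrow> 'b set \<Rightarrow> bool" where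
  "times_differentiable_on 0 f S \<longleftrightarrow> continuous_on S f"
| "times_differentiable_on (Suc k) f S \<longleftrightarrow>
     (\<forall>x\<in>S. f differentiable (at x)) \<and>
     (\<forall>v. times_differentiable_on k (\<lambda>x. frechet_derivative f (at x) v) S)"

definition smooth_on :: "('b::real_normed_vector \<Rightarrow> 'c::real_normed_vector) \<Rightarrow> 'b set \<Rightarrow> bool" where
  "smooth_on f S \<longleftrightarrow> (\<forall>k. times_differentiable_on k f S)"

text \<open>
  The manifold is a whole type \<open>'a\<close> (Hausdorff and second countable by its type classes) with a
  smooth atlas, not required to be maximal. A chart \<open>(U, c)\<close> is a domain together with a coordinate
  map; only the values of \<open>c\<close> on \<open>U\<close> matter.
\<close>

type_synonym ('a, 'm) atlas = "('a set \<times> ('a \<Rightarrow> real ^ 'm)) set"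

definition smooth_atlas ::
    "('a::{t2_space, second_countable_topology}, 'm::finite) atlas \<Rightarrow> bool" where
  "smooth_atlas A \<longleftrightarrow>
     (\<Union>(U, c)\<in>A. U) = UNIV \<and>
     (\<forall>(U, c)\<in>A. open U \<and> open (c ` U) \<and> homeomorphism U (c ` U) c (inv_into U c)) \<and>
     (\<forall>(U, c)\<in>A. \<forall>(V, d)\<in>A. smooth_on (d \<circ> inv_into U c) (c ` (U \<inter> V)))"

definition smooth_functions ::
    "('a::{t2_space, second_countable_topology}, 'm::finite) atlas \<Rightarrow> ('a \<Rightarrow> real) set" where
  "smooth_functions A = {f. \<forall>(U, c)\<in>A. smooth_on (f \<circ> inv_into U c) (c ` U)}"

section \<open>Tangent vectors and vector fields\<close>

type_synonym 'a tangent = "('a \<Rightarrow> real) \<Rightarrow> real"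
type_synonym 'a vfield = "'a \<Rightarrow> 'a tangent"

definition scale_tangent :: "real \<Rightarrow> 'a tangent \<Rightarrow> 'a tangent"  (infixr \<open>*\<^sub>T\<close> 75) where
  "r *\<^sub>T u = (\<lambda>f. r * u f)"

interpretation tangent: vector_space scale_tangent
  by unfold_locales (auto simp: scale_tangent_def fun_eq_iff algebra_simps)

text \<open>
  Tangent vectors are the derivations of the algebra of smooth functions at a point. The value
  \<open>0\<close> on non-smooth functions makes equality of derivations equality of HOL functions.
\<close>

definition tangent_space ::
    "('a::{t2_space, second_countable_topology}, 'm::finite) atlas \<Rightarrow> 'a \<Rightarrow> 'a tangent set" where
  "tangent_space A p = {u.
     (\<forall>f\<in>smooth_functions A. \<forall>h\<in>smooth_functions A. \<forall>r s.
        u (\<lambda>q. r * f q + s * h q) = r * u f + s * u h) \<and>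
     (\<forall>f\<in>smooth_functions A. \<forall>h\<in>smooth_functions A. u (f * h) = u f * h p + f p * u h) \<and>
     (\<forall>f. f \<notin> smooth_functions A \<longrightarrow> u f = 0)}"

definition deriv_along :: "'a vfield \<Rightarrow> ('a \<Rightarrow> real) \<Rightarrow> ('a \<Rightarrow> real)" where
  "deriv_along X f = (\<lambda>p. X p f)"

definition vector_fields ::
    "('a::{t2_space, second_countable_topology}, 'm::finite) atlas \<Rightarrow> 'a vfield set" where
  "vector_fields A = {X. (\<forall>p. X p \<in> tangent_space A p) \<and>
     (\<forall>f\<in>smooth_functions A. deriv_along X f \<in> smooth_functions A)}"

definition scale_vfield :: "('a \<Rightarrow> real) \<Rightarrow> 'a vfield \<Rightarrow> 'a vfield"  (infixr \<open>*\<^sub>V\<close> 75) where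
  "f *\<^sub>V X = (\<lambda>p. f p *\<^sub>T X p)"

definition lie_bracket :: "'a vfield \<Rightarrow> 'a vfield \<Rightarrow> 'a vfield" where
  "lie_bracket X Y = (\<lambda>p f. X p (deriv_along Y f) - Y p (deriv_along X f))"

text \<open>
  A basis of the tangent space is indexed by the coordinate type \<open>'m\<close>, so that matrices of
  bilinear forms have type \<open>real ^ 'm ^ 'm\<close>.
\<close>

definition tangent_basis :: "('a::{t2_space, second_countable_topology}, 'm::finite) atlas \<Rightarrow>
    'a \<Rightarrow> ('m \<Rightarrow> 'a tangent) \<Rightarrow> bool" where
  "tangent_basis A p e \<longleftrightarrow>
     inj e \<and> tangent.independent (range e) \<and> tangent.span (range e) = tangent_space A p"

section \<open>Tensor fields\<close>

text \<open>Tensor fields act fibrewise, and are smooth if they map smooth fields to smooth ones.\<close>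

type_synonym 'a one_form = "'a \<Rightarrow> 'a tangent \<Rightarrow> real"
type_synonym 'a bilinear_field = "'a \<Rightarrow> 'a tangent \<Rightarrow> 'a tangent \<Rightarrow> real"
type_synonym 'a endo_field = "'a \<Rightarrow> 'a tangent \<Rightarrow> 'a tangent"

definition eval1 :: "'a one_form \<Rightarrow> 'a vfield \<Rightarrow> ('a \<Rightarrow> real)" where
  "eval1 \<eta> X = (\<lambda>p. \<eta> p (X p))"

definition eval2 :: "'a bilinear_field \<Rightarrow> 'a vfield \<Rightarrow> 'a vfield \<Rightarrow> ('a \<Rightarrow> real)" where
  "eval2 g X Y = (\<lambda>p. g p (X p) (Y p))"

definition endo_apply :: "'a endo_field \<Rightarrow> 'a vfield \<Rightarrow> 'a vfield" where
  "endo_apply \<phi> X = (\<lambda>p. \<phi> p (X p))"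

definition smooth_one_form ::
    "('a::{t2_space, second_countable_topology}, 'm::finite) atlas \<Rightarrow> 'a one_form \<Rightarrow> bool" where
  "smooth_one_form A \<eta> \<longleftrightarrow>
     (\<forall>p. \<forall>u\<in>tangent_space A p. \<forall>w\<in>tangent_space A p. \<forall>r s.
        \<eta> p (r *\<^sub>T u + s *\<^sub>T w) = r * \<eta> p u + s * \<eta> p w) \<and>
     (\<forall>X\<in>vector_fields A. eval1 \<eta> X \<in> smooth_functions A)"

definition smooth_endo_field ::
    "('a::{t2_space, second_countable_topology}, 'm::finite) atlas \<Rightarrow> 'a endo_field \<Rightarrow> bool" where
  "smooth_endo_field A \<phi> \<longleftrightarrow>
     (\<forall>p. \<forall>u\<in>tangent_space A p. \<phi> p u \<in> tangent_space A p) \<and>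
     (\<forall>p. \<forall>u\<in>tangent_space A p. \<forall>w\<in>tangent_space A p. \<forall>r s.
        \<phi> p (r *\<^sub>T u + s *\<^sub>T w) = r *\<^sub>T \<phi> p u + s *\<^sub>T \<phi> p w) \<and>
     (\<forall>X\<in>vector_fields A. endo_apply \<phi> X \<in> vector_fields A)"

definition smooth_symmetric_bilinear ::
    "('a::{t2_space, second_countable_topology}, 'm::finite) atlas \<Rightarrow> 'a bilinear_field \<Rightarrow> bool" where
  "smooth_symmetric_bilinear A g \<longleftrightarrow>
     (\<forall>p. \<forall>u\<in>tangent_space A p. \<forall>w\<in>tangent_space A p. g p u w = g p w u) \<and>
     (\<forall>p. \<forall>u\<in>tangent_space A p. \<forall>w\<in>tangent_space A p. \<forall>z\<in>tangent_space A p. \<forall>r s.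
        g p (r *\<^sub>T u + s *\<^sub>T w) z = r * g p u z + s * g p w z) \<and>
     (\<forall>X\<in>vector_fields A. \<forall>Y\<in>vector_fields A. eval2 g X Y \<in> smooth_functions A)"

text \<open>
  Signature \<open>(k, l)\<close> at every point, witnessed by an orthonormal basis with \<open>k\<close> vectors of square
  \<open>1\<close> and \<open>l\<close> of square \<open>-1\<close>. In particular \<open>g\<close> is nondegenerate.
\<close>

definition pseudo_riemannian_metric :: "('a::{t2_space, second_countable_topology}, 'm::finite) atlas \<Rightarrow>
    nat \<Rightarrow> nat \<Rightarrow> 'a bilinear_field \<Rightarrow> bool" where
  "pseudo_riemannian_metric A k l g \<longleftrightarrow>
     smooth_symmetric_bilinear A g \<and>
     (\<forall>p. \<exists>e P. tangent_basis A p e \<and> card P = k \<and> card (- P) = l \<and>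
        (\<forall>i j. g p (e i) (e j) = (if i \<noteq> j then 0 else if i \<in> P then 1 else - 1)))"

section \<open>Levi-Civita connection and curvature\<close>

definition levi_civita_connection :: "('a::{t2_space, second_countable_topology}, 'm::finite) atlas \<Rightarrow>
    'a bilinear_field \<Rightarrow> ('a vfield \<Rightarrow> 'a vfield \<Rightarrow> 'a vfield) \<Rightarrow> bool" where
  "levi_civita_connection A g D \<longleftrightarrow>
     (\<forall>X\<in>vector_fields A. \<forall>Y\<in>vector_fields A. D X Y \<in> vector_fields A) \<and>
     (\<forall>X\<in>vector_fields A. \<forall>Y\<in>vector_fields A. \<forall>Z\<in>vector_fields A.
        D (X + Y) Z = D X Z + D Y Z \<and> D X (Y + Z) = D X Y + D X Z) \<and>
     (\<forall>f\<in>smooth_functions A. \<forall>X\<in>vector_fields A. \<forall>Y\<in>vector_fields A.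
        D (f *\<^sub>V X) Y = f *\<^sub>V D X Y \<and>
        D X (f *\<^sub>V Y) = deriv_along X f *\<^sub>V Y + f *\<^sub>V D X Y) \<and>
     (\<forall>X\<in>vector_fields A. \<forall>Y\<in>vector_fields A. D X Y - D Y X = lie_bracket X Y) \<and>
     (\<forall>X\<in>vector_fields A. \<forall>Y\<in>vector_fields A. \<forall>Z\<in>vector_fields A.
        deriv_along X (eval2 g Y Z) = eval2 g (D X Y) Z + eval2 g Y (D X Z))"

definition curvature :: "('a vfield \<Rightarrow> 'a vfield \<Rightarrow> 'a vfield) \<Rightarrow>
    'a vfield \<Rightarrow> 'a vfield \<Rightarrow> 'a vfield \<Rightarrow> 'a vfield" where
  "curvature D X Y Z = D X (D Y Z) - D Y (D X Z) - D (lie_bracket X Y) Z"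

definition curvature4 :: "'a bilinear_field \<Rightarrow> ('a vfield \<Rightarrow> 'a vfield \<Rightarrow> 'a vfield) \<Rightarrow>
    'a vfield \<Rightarrow> 'a vfield \<Rightarrow> 'a vfield \<Rightarrow> 'a vfield \<Rightarrow> ('a \<Rightarrow> real)" where
  "curvature4 g D X Y Z W = eval2 g (curvature D X Y Z) W"

text \<open>
  Vector fields that form a basis at \<open>p\<close>, and hence also near \<open>p\<close>. By means of cut-off functions,
  every local basis around \<open>p\<close> agrees near \<open>p\<close> with one of this kind.
\<close>

definition frame_at :: "('a::{t2_space, second_countable_topology}, 'm::finite) atlas \<Rightarrow>
    'a \<Rightarrow> ('m \<Rightarrow> 'a vfield) \<Rightarrow> bool" where
  "frame_at A p e \<longleftrightarrow> (\<forall>i. e i \<in> vector_fields A) \<and> tangent_basis A p (\<lambda>i. e i p)"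

definition ricci_sum :: "'a bilinear_field \<Rightarrow> ('a vfield \<Rightarrow> 'a vfield \<Rightarrow> 'a vfield) \<Rightarrow>
    ('m::finite \<Rightarrow> 'a vfield) \<Rightarrow> 'a vfield \<Rightarrow> 'a vfield \<Rightarrow> ('a \<Rightarrow> real)" where
  "ricci_sum g D e Y Z = (\<lambda>p.
     \<Sum>i\<in>UNIV. \<Sum>j\<in>UNIV. matrix_inv (\<chi> a b. g p (e a p) (e b p)) $ i $ j *
       curvature4 g D (e i) Y Z (e j) p)"

text \<open>The choice of the frame is immaterial, because the curvature is tensorial.\<close>

definition ricci :: "('a::{t2_space, second_countable_topology}, 'm::finite) atlas \<Rightarrow>
    'a bilinear_field \<Rightarrow> ('a vfield \<Rightarrow> 'a vfield \<Rightarrow> 'a vfield) \<Rightarrow>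
    'a vfield \<Rightarrow> 'a vfield \<Rightarrow> ('a \<Rightarrow> real)" where
  "ricci A g D Y Z = (\<lambda>p. ricci_sum g D (SOME e. frame_at A p e) Y Z p)"

definition lie_derivative_bilinear ::
    "'a vfield \<Rightarrow> 'a bilinear_field \<Rightarrow> 'a vfield \<Rightarrow> 'a vfield \<Rightarrow> ('a \<Rightarrow> real)" where
  "lie_derivative_bilinear V g X Y =
     deriv_along V (eval2 g X Y) - eval2 g (lie_bracket V X) Y - eval2 g X (lie_bracket V Y)"

section \<open>Almost contact B-metric manifolds\<close>

definition almost_contact_B_metric ::
    "nat \<Rightarrow> ('a::{t2_space, second_countable_topology}, 'm::finite) atlas \<Rightarrow>
     'a endo_field \<Rightarrow> 'a vfield \<Rightarrow> 'a one_form \<Rightarrow> 'a bilinear_field \<Rightarrow> bool" where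
  "almost_contact_B_metric n A \<phi> \<xi> \<eta> g \<longleftrightarrow>
     CARD('m) = 2 * n + 1 \<and> smooth_atlas A \<and>
     smooth_endo_field A \<phi> \<and> \<xi> \<in> vector_fields A \<and> smooth_one_form A \<eta> \<and>
     pseudo_riemannian_metric A (n + 1) n g \<and>
     endo_apply \<phi> \<xi> = 0 \<and>
     eval1 \<eta> \<xi> = 1 \<and>
     (\<forall>X\<in>vector_fields A.
        endo_apply \<phi> (endo_apply \<phi> X) = - X + eval1 \<eta> X *\<^sub>V \<xi> \<and>
        eval1 \<eta> (endo_apply \<phi> X) = 0) \<and>
     (\<forall>X\<in>vector_fields A. \<forall>Y\<in>vector_fields A.
        eval2 g (endo_apply \<phi> X) (endo_apply \<phi> Y) = - eval2 g X Y + eval1 \<eta> X * eval1 \<eta> Y)"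

definition associated_metric ::
    "'a endo_field \<Rightarrow> 'a one_form \<Rightarrow> 'a bilinear_field \<Rightarrow> 'a bilinear_field" where
  "associated_metric \<phi> \<eta> g = (\<lambda>p u w. g p u (\<phi> p w) + \<eta> p u * \<eta> p w)"

definition cov_deriv_endo :: "('a vfield \<Rightarrow> 'a vfield \<Rightarrow> 'a vfield) \<Rightarrow> 'a endo_field \<Rightarrow>
    'a vfield \<Rightarrow> 'a vfield \<Rightarrow> 'a vfield" where
  "cov_deriv_endo D \<phi> X Y = D X (endo_apply \<phi> Y) - endo_apply \<phi> (D X Y)"

definition sasaki_like :: "('a::{t2_space, second_countable_topology}, 'm::finite) atlas \<Rightarrow>
    'a endo_field \<Rightarrow> 'a vfield \<Rightarrow> 'a one_form \<Rightarrow> 'a bilinear_field \<Rightarrow>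
    ('a vfield \<Rightarrow> 'a vfield \<Rightarrow> 'a vfield) \<Rightarrow> bool" where
  "sasaki_like A \<phi> \<xi> \<eta> g D \<longleftrightarrow>
     (\<forall>X\<in>vector_fields A. \<forall>Y\<in>vector_fields A.
        cov_deriv_endo D \<phi> X Y =
          - (eval2 g X Y *\<^sub>V \<xi>) - eval1 \<eta> Y *\<^sub>V X + (\<lambda>p. 2 * \<eta> p (X p) * \<eta> p (Y p)) *\<^sub>V \<xi>)"

definition ricci_like_soliton :: "('a::{t2_space, second_countable_topology}, 'm::finite) atlas \<Rightarrow>
    'a endo_field \<Rightarrow> 'a one_form \<Rightarrow> 'a bilinear_field \<Rightarrow>
    ('a vfield \<Rightarrow> 'a vfield \<Rightarrow> 'a vfield) \<Rightarrow> 'a vfield \<Rightarrow> real \<Rightarrow> real \<Rightarrow> real \<Rightarrow> bool" where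
  "ricci_like_soliton A \<phi> \<eta> g D v lam \<mu> \<nu> \<longleftrightarrow>
     v \<in> vector_fields A \<and>
     (\<forall>X\<in>vector_fields A. \<forall>Y\<in>vector_fields A. \<forall>p.
        1 / 2 * lie_derivative_bilinear v g X Y p + ricci A g D X Y p
        + lam * eval2 g X Y p + \<mu> * eval2 (associated_metric \<phi> \<eta> g) X Y p
        + \<nu> * (eval1 \<eta> X p * eval1 \<eta> Y p) = 0)"

end

theory Submission
  imports Defs "HOL-Computational_Algebra.Polynomial"
begin

text \<open>
  Write \<open>G1 = g - \<eta> \<otimes> \<eta>\<close> and \<open>G2 (x, y) = g (\<phi> x, y)\<close>. On a Sasaki-like manifold \<open>\<nabla>\<xi> = - \<phi>\<close>, and the
  flow of \<open>\<xi>\<close> preserves \<open>\<phi>\<close> and \<open>\<eta>\<close> and rotates the transversal metrics into each other: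
  \<open>L\<^sub>\<xi> G1 = - 2 G2\<close>, \<open>L\<^sub>\<xi> G2 = 2 G1\<close>. Two facts on the Ricci tensor are needed: \<open>\<rho> (x, \<xi>) = 2n \<eta> (x)\<close>, and
  \<open>L\<^sub>\<xi> \<rho> = 0\<close>. The latter holds because \<open>L\<^sub>\<xi> \<nabla> = 2 G1 \<otimes> \<xi>\<close> (lemma \<open>lie_xi_connection\<close>), which determines
  \<open>L\<^sub>\<xi> R\<close>, and its contraction is a multiple of the trace of \<open>\<phi>\<close>, which is \<open>0\<close> (lemma \<open>lie_xi_ricci\<close>).

  Let \<open>f = \<eta> (v)\<close>, \<open>w = [v, \<xi>]\<close> and \<open>c = \<lambda> + \<mu> + \<nu> + 2n\<close>. As \<open>\<nabla>\<^sub>\<xi> v = \<nabla>\<^sub>v \<xi> - w = - \<phi> v - w\<close>, the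
  claims are \<open>c = 0\<close> and \<open>w = 0\<close>. The soliton equation with one argument \<open>\<xi>\<close> says that \<open>g (w, _) = df + 2 c \<eta>\<close>,
  whence \<open>\<eta> (w) = c\<close>, \<open>\<xi> f = - c\<close> and \<open>[\<xi>, w] = 2 \<phi> w\<close>. Differentiating the soliton equation along
  \<open>\<xi>\<close> eliminates \<open>\<rho>\<close> and gives \<open>L\<^sub>v G2\<close> up to a term \<open>L\<^sub>w g\<close>, which is absorbed if \<open>v\<close> is replaced by
  \<open>u = v - f \<xi> - \<phi> w / 2\<close>. This field commutes with \<open>\<xi>\<close>, and \<open>L\<^sub>u G2\<close> is a combination of \<open>G1\<close> and \<open>G2\<close> with
  coefficients made of \<open>f\<close> and constants. Two more derivatives along \<open>\<xi>\<close> lead to \<open>c G2 = 0\<close>, so \<open>c = 0\<close>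
  (lemma \<open>c_zero\<close>).

  Now \<open>L\<^sub>u\<close> multiplies the complex metric \<open>G1 - i G2\<close> by the function \<open>- 2 \<lambda> - i a\<close>, with \<open>a = 2 \<mu> - 2 f\<close>, and
  \<open>u\<close> preserves \<open>\<phi>\<close>. This metric is holomorphic transversally to \<open>\<xi>\<close>, which is an identity between Lie
  brackets (lemma \<open>tachibana_G1\<close>) and therefore is inherited by its Lie derivative. Hence the factor is
  holomorphic; its real part is constant, so \<open>f\<close> is constant too (lemma \<open>a_constant\<close>), and \<open>g (w, _) = df = 0\<close>.

  All these identities concern global vector fields. To define and differentiate traces, and to
  test the vanishing of a tensor on fields, there must be enough global fields; they are cut off
  coordinate fields (lemma \<open>cut_off_frame_exists\<close>).
\<close>

section \<open>Smooth functions on open sets\<close>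

lemma times_differentiable_on_cong:
  assumes "open S" "\<And>x. x \<in> S \<Longrightarrow> f x = h x" "times_differentiable_on k f S"
  shows "times_differentiable_on k h S"
  using assms(2,3)
proof (induction k arbitrary: f h)
  case 0
  then show ?case by (simp cong: continuous_on_cong)
next
  case (Suc k)
  have fd: "frechet_derivative f (at x) = frechet_derivative h (at x)" "h differentiable (at x)"
    if x: "x \<in> S" for x
  proof -
    have "(f has_derivative frechet_derivative f (at x)) (at x)"
      using Suc.prems(2) x by (auto simp: frechet_derivative_works)
    then have "(h has_derivative frechet_derivative f (at x)) (at x)"
      by (rule has_derivative_transform_within_open[OF _ assms(1) x]) (use Suc.prems(1) in auto)
    then show "frechet_derivative f (at x) = frechet_derivative h (at x)" "h differentiable (at x)"
      by (auto dest: frechet_derivative_at intro: differentiableI)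
  qed
  have "times_differentiable_on k (\<lambda>x. frechet_derivative h (at x) v) S" for v
    by (rule Suc.IH[of "\<lambda>x. frechet_derivative f (at x) v"]) (use Suc.prems(2) fd(1) in simp_all)
  then show ?case using fd(2) by simp
qed

lemma times_differentiable_on_subset:
  "times_differentiable_on k f T \<Longrightarrow> S \<subseteq> T \<Longrightarrow> times_differentiable_on k f S"
  by (induction k arbitrary: f) (auto intro: continuous_on_subset)

lemma times_differentiable_on_SucD:
  "times_differentiable_on (Suc k) f S \<Longrightarrow> times_differentiable_on k f S"
proof (induction k arbitrary: f)
  case 0
  then show ?case
    by (auto intro!: differentiable_imp_continuous_on simp: differentiable_on_def differentiable_at_withinI)
next
  case (Suc k)
  have "times_differentiable_on k (\<lambda>x. frechet_derivative f (at x) v) S" for v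
    by (rule Suc.IH) (use Suc.prems in simp)
  then show ?case using Suc.prems by simp
qed

lemma times_differentiable_on_const: "times_differentiable_on k (\<lambda>_. c) S"
  by (induction k arbitrary: c) (auto simp: frechet_derivative_const)

lemma times_differentiable_on_bounded_linear:
  "bounded_linear f \<Longrightarrow> times_differentiable_on k f S"
  by (cases k) (auto simp: linear_continuous_on bounded_linear_imp_differentiable
      frechet_derivative_at[OF bounded_linear_imp_has_derivative, symmetric] times_differentiable_on_const)

lemma times_differentiable_on_linear_compose:
  assumes "bounded_linear L" "open S"
  shows "times_differentiable_on k f S \<Longrightarrow> times_differentiable_on k (\<lambda>x. L (f x)) S"
proof (induction k arbitrary: f)
  case 0
  then show ?case by (auto intro: bounded_linear.continuous_on[OF assms(1)])
next
  case (Suc k)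
  have d: "((\<lambda>x. L (f x)) has_derivative (\<lambda>v. L (frechet_derivative f (at x) v))) (at x)"
    if "x \<in> S" for x
    using Suc.prems that
    by (auto intro!: bounded_linear.has_derivative[OF assms(1)] simp: frechet_derivative_works[symmetric])
  have "times_differentiable_on k (\<lambda>x. frechet_derivative (\<lambda>x. L (f x)) (at x) v) S" for v
    by (rule times_differentiable_on_cong[OF assms(2) _ Suc.IH[of "\<lambda>x. frechet_derivative f (at x) v"]])
      (assumption | rule fun_cong[OF frechet_derivative_at[OF d]] | use Suc.prems in \<open>simp\<close>)+
  moreover have "\<forall>x\<in>S. (\<lambda>x. L (f x)) differentiable (at x)"
    by (intro ballI) (rule differentiableI[OF d])
  ultimately show ?case by simp
qed

lemma times_differentiable_on_add:
  assumes "open S"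
  shows "times_differentiable_on k f S \<Longrightarrow> times_differentiable_on k h S \<Longrightarrow>
    times_differentiable_on k (\<lambda>x. f x + h x) S"
proof (induction k arbitrary: f h)
  case 0
  then show ?case by (auto intro: continuous_intros)
next
  case (Suc k)
  have d: "((\<lambda>x. f x + h x) has_derivative
      (\<lambda>v. frechet_derivative f (at x) v + frechet_derivative h (at x) v)) (at x)"
    if "x \<in> S" for x
    using Suc.prems that
    by (auto intro!: has_derivative_add simp: frechet_derivative_works[symmetric])
  have "times_differentiable_on k (\<lambda>x. frechet_derivative (\<lambda>x. f x + h x) (at x) v) S" for v
    by (rule times_differentiable_on_cong[OF assms _
        Suc.IH[of "\<lambda>x. frechet_derivative f (at x) v" "\<lambda>x. frechet_derivative h (at x) v"]])
      (assumption | rule fun_cong[OF frechet_derivative_at[OF d]] | use Suc.prems in \<open>simp\<close>)+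
  moreover have "\<forall>x\<in>S. (\<lambda>x. f x + h x) differentiable (at x)"
    by (intro ballI) (rule differentiableI[OF d])
  ultimately show ?case by simp
qed

lemma times_differentiable_on_sum:
  assumes "open S" "finite I" "\<And>i. i \<in> I \<Longrightarrow> times_differentiable_on k (f i) S"
  shows "times_differentiable_on k (\<lambda>x. \<Sum>i\<in>I. f i x) S"
  using assms(2,3)
proof induction
  case empty
  then show ?case by (simp add: times_differentiable_on_const)
next
  case (insert i I)
  then show ?case
    using times_differentiable_on_add[OF assms(1), of k "f i" "\<lambda>x. \<Sum>i\<in>I. f i x"] by simp
qed

lemma times_differentiable_on_scaleR:
  assumes "open S"
  shows "times_differentiable_on k f S \<Longrightarrow> times_differentiable_on k h S \<Longrightarrow>
    times_differentiable_on k (\<lambda>x. f x *\<^sub>R h x) S"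
proof (induction k arbitrary: f h)
  case 0
  then show ?case by (auto intro: continuous_intros)
next
  case (Suc k)
  have d: "((\<lambda>x. f x *\<^sub>R h x) has_derivative
      (\<lambda>v. f x *\<^sub>R frechet_derivative h (at x) v + frechet_derivative f (at x) v *\<^sub>R h x)) (at x)"
    if "x \<in> S" for x
    using Suc.prems that
    by (auto intro!: has_derivative_scaleR simp: frechet_derivative_works[symmetric])
  have "times_differentiable_on k (\<lambda>x. frechet_derivative (\<lambda>x. f x *\<^sub>R h x) (at x) v) S" for v
  proof (rule times_differentiable_on_cong[OF assms])
    show "times_differentiable_on k
      (\<lambda>x. f x *\<^sub>R frechet_derivative h (at x) v + frechet_derivative f (at x) v *\<^sub>R h x) S"
      using Suc.prems[THEN times_differentiable_on_SucD] Suc.prems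
      by (intro times_differentiable_on_add assms Suc.IH) auto
  qed (rule fun_cong[OF frechet_derivative_at[OF d]])
  moreover have "\<forall>x\<in>S. (\<lambda>x. f x *\<^sub>R h x) differentiable (at x)"
    by (intro ballI) (rule differentiableI[OF d])
  ultimately show ?case by simp
qed

text \<open>
  The derivative of a composition is a sum of products of directional derivatives of the outer
  map, composed with the inner one, and of coordinates of directional derivatives of the inner map;
  so the order of differentiability goes through an induction.
\<close>
lemma times_differentiable_on_compose:
  fixes f :: "'b::real_normed_vector \<Rightarrow> 'c::euclidean_space" and h :: "'c \<Rightarrow> 'd::real_normed_vector"
  assumes "open S" "open T" "f ` S \<subseteq> T"
  shows "times_differentiable_on k f S \<Longrightarrow> times_differentiable_on k h T \<Longrightarrow>
    times_differentiable_on k (\<lambda>x. h (f x)) S"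
proof (induction k arbitrary: h)
  case 0
  then show ?case using assms(3) by (auto intro: continuous_on_compose2)
next
  case (Suc k)
  let ?d = "\<lambda>x v. \<Sum>b\<in>Basis. (frechet_derivative f (at x) v \<bullet> b) *\<^sub>R frechet_derivative h (at (f x)) b"
  have d: "((\<lambda>x. h (f x)) has_derivative ?d x) (at x)" if "x \<in> S" for x
  proof -
    have hd: "(h has_derivative frechet_derivative h (at (f x))) (at (f x))"
      and fd: "(f has_derivative frechet_derivative f (at x)) (at x)"
      using Suc.prems that assms(3) by (auto simp: frechet_derivative_works[symmetric])
    interpret h: linear "frechet_derivative h (at (f x))"
      using hd by (rule has_derivative_linear)
    have "frechet_derivative h (at (f x)) (frechet_derivative f (at x) v) = ?d x v" for v
      by (subst (1) euclidean_representation[symmetric, of "frechet_derivative f (at x) v"])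
        (simp only: h.sum h.scaleR)
    then show ?thesis using has_derivative_compose[OF fd hd] by simp
  qed
  have "times_differentiable_on k (\<lambda>x. frechet_derivative (\<lambda>x. h (f x)) (at x) v) S" for v
  proof (rule times_differentiable_on_cong[OF assms(1)])
    show "times_differentiable_on k (\<lambda>x. ?d x v) S"
      using times_differentiable_on_SucD[OF Suc.prems(1)] Suc.prems
      by (intro times_differentiable_on_sum assms times_differentiable_on_scaleR Suc.IH
          times_differentiable_on_linear_compose[of "\<lambda>x. x \<bullet> b" for b])
        (auto intro: bounded_linear_intros)
  qed (rule fun_cong[OF frechet_derivative_at[OF d]])
  moreover have "\<forall>x\<in>S. (\<lambda>x. h (f x)) differentiable (at x)"
    by (intro ballI) (rule differentiableI[OF d])
  ultimately show ?case by simp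
qed

lemma smooth_on_const: "smooth_on (\<lambda>_. c) S"
  by (simp add: smooth_on_def times_differentiable_on_const)

lemma smooth_on_bounded_linear: "bounded_linear f \<Longrightarrow> smooth_on f S"
  by (simp add: smooth_on_def times_differentiable_on_bounded_linear)

lemma smooth_on_add:
  "open S \<Longrightarrow> smooth_on f S \<Longrightarrow> smooth_on h S \<Longrightarrow> smooth_on (\<lambda>x. f x + h x) S"
  by (simp add: smooth_on_def times_differentiable_on_add)

lemma smooth_on_mult:
  fixes f h :: "'b::real_normed_vector \<Rightarrow> real"
  shows "open S \<Longrightarrow> smooth_on f S \<Longrightarrow> smooth_on h S \<Longrightarrow> smooth_on (\<lambda>x. f x * h x) S"
  using times_differentiable_on_scaleR[of S _ f h] by (simp add: smooth_on_def)

lemma smooth_on_compose: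
  fixes f :: "'b::real_normed_vector \<Rightarrow> 'c::euclidean_space"
  shows "open S \<Longrightarrow> open T \<Longrightarrow> f ` S \<subseteq> T \<Longrightarrow> smooth_on f S \<Longrightarrow> smooth_on h T \<Longrightarrow>
    smooth_on (\<lambda>x. h (f x)) S"
  by (simp add: smooth_on_def times_differentiable_on_compose)

lemma smooth_on_cong:
  "open S \<Longrightarrow> (\<And>x. x \<in> S \<Longrightarrow> f x = h x) \<Longrightarrow> smooth_on f S \<Longrightarrow> smooth_on h S"
  unfolding smooth_on_def by (blast intro: times_differentiable_on_cong)

lemma smooth_on_subset: "smooth_on f T \<Longrightarrow> S \<subseteq> T \<Longrightarrow> smooth_on f S"
  unfolding smooth_on_def by (blast intro: times_differentiable_on_subset)

lemma smooth_on_Un: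
  assumes "smooth_on f S" "smooth_on f T" "open S" "open T"
  shows "smooth_on f (S \<union> T)"
proof -
  have "times_differentiable_on k f (S \<union> T)"
    if "times_differentiable_on k f S" "times_differentiable_on k f T" for k
    using that by (induction k arbitrary: f) (auto intro: continuous_on_open_Un assms)
  then show ?thesis using assms by (auto simp: smooth_on_def)
qed

lemma smooth_on_differentiable: "smooth_on f S \<Longrightarrow> x \<in> S \<Longrightarrow> f differentiable (at x)"
  unfolding smooth_on_def by (metis times_differentiable_on.simps(2))

lemma smooth_on_frechet_derivative:
  "smooth_on f S \<Longrightarrow> smooth_on (\<lambda>x. frechet_derivative f (at x) v) S"
  unfolding smooth_on_def by (metis times_differentiable_on.simps(2))

text \<open>
  \<open>p (1 / t) e^(- 1 / t)\<close> continued by \<open>0\<close>. The polynomial factor makes the family closed under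
  differentiation.
\<close>
definition flat_exp :: "real poly \<Rightarrow> real \<Rightarrow> real" where
  "flat_exp p t = (if t > 0 then poly p (1 / t) * exp (- (1 / t)) else 0)"

lemma tendsto_poly_exp_minus: "((\<lambda>x::real. poly p x * exp (- x)) \<longlongrightarrow> 0) at_top"
proof -
  have "((\<lambda>x. \<Sum>i\<le>degree p. coeff p i * (x ^ i / exp x)) \<longlongrightarrow> (\<Sum>i\<le>degree p. coeff p i * 0)) at_top"
    by (intro tendsto_intros tendsto_power_div_exp_0)
  then show ?thesis
    by (simp add: poly_altdef exp_minus sum_divide_distrib field_simps)
qed

text \<open>
  At \<open>0\<close> the difference quotient is again a polynomial in \<open>1 / t\<close> times \<open>e^(- 1 / t)\<close>, so it tends to \<open>0\<close>.
\<close>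
lemma flat_exp_has_derivative:
  "(flat_exp p has_real_derivative flat_exp ([:0, 0, 1:] * (p - pderiv p)) t) (at t)"
proof (cases t "0 :: real" rule: linorder_cases)
  case less
  have "((\<lambda>_. 0) has_real_derivative 0) (at t)" by simp
  then have "(flat_exp p has_real_derivative 0) (at t)"
    by (rule has_field_derivative_transform_within_open[where S="{..<0}"]) (use less in \<open>auto simp: flat_exp_def\<close>)
  then show ?thesis using less by (simp add: flat_exp_def)
next
  case greater
  have "((\<lambda>t. poly p (1 / t) * exp (- (1 / t))) has_real_derivative
      flat_exp ([:0, 0, 1:] * (p - pderiv p)) t) (at t)"
    using greater by (auto intro!: derivative_eq_intros poly_DERIV[THEN DERIV_chain2]
        simp: flat_exp_def field_simps power2_eq_square)
  then show ?thesis
    by (rule has_field_derivative_transform_within_open[where S="{0<..}"]) (use greater in \<open>auto simp: flat_exp_def\<close>)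
next
  case equal
  have R: "((\<lambda>t. poly ([:0, 1:] * p) (1 / t) * exp (- (1 / t))) \<longlongrightarrow> 0) (at_right 0)"
    using filterlim_compose[OF tendsto_poly_exp_minus[of "[:0, 1:] * p"] filterlim_inverse_at_top_right]
    by (simp only: inverse_eq_divide)
  have "((\<lambda>t. flat_exp p t / t) \<longlongrightarrow> 0) (at_right 0)"
    by (rule Lim_transform_eventually[OF R])
      (auto simp: eventually_at_filter flat_exp_def field_simps)
  moreover have "((\<lambda>t. flat_exp p t / t) \<longlongrightarrow> 0) (at_left 0)"
    by (rule Lim_transform_eventually[of "\<lambda>_. 0"]) (auto simp: eventually_at_filter flat_exp_def)
  ultimately have "((\<lambda>t. flat_exp p t / t) \<longlongrightarrow> 0) (at 0)"
    by (simp add: filterlim_split_at)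
  then show ?thesis using equal
    by (simp add: has_field_derivative_iff flat_exp_def[of _ 0])
qed

lemma smooth_on_flat_exp: "smooth_on (flat_exp p) S"
proof -
  have "times_differentiable_on k (\<lambda>t. v * flat_exp p t) UNIV" for k v
  proof (induction k arbitrary: p v)
    case 0
    have "isCont (flat_exp p) t" for t
      using flat_exp_has_derivative DERIV_isCont by blast
    then show ?case by (auto intro!: continuous_intros simp: continuous_on_eq_continuous_at)
  next
    case (Suc k)
    let ?q = "[:0, 0, 1:] * (p - pderiv p)"
    have d: "((\<lambda>t. v * flat_exp p t) has_derivative (\<lambda>u. (u * v) * flat_exp ?q t)) (at t)" for t
      using DERIV_cmult[OF flat_exp_has_derivative[of p t], of v]
      unfolding has_field_derivative_def
      by (rule has_derivative_eq_rhs) (simp add: fun_eq_iff mult_ac)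
    then show ?case
      using Suc.IH[of "u * v" ?q for u] frechet_derivative_at[OF d, symmetric]
      by (auto simp: differentiable_def simp del: mult_pCons_left)
  qed
  from this[of _ 1] show ?thesis
    by (auto simp: smooth_on_def intro: times_differentiable_on_subset)
qed

text \<open>
  With \<open>r\<close> the radius of a closed ball around \<open>y\<close> in \<open>W\<close>, the function \<open>e^(- 1 / (r^2 - |x - y|^2))\<close>
  is supported in this ball.
\<close>
lemma smooth_bump_exists:
  fixes y :: "'b::euclidean_space"
  assumes "open W" "y \<in> W"
  obtains b :: "'b \<Rightarrow> real" and K where "smooth_on b UNIV" "compact K" "K \<subseteq> W" "b y \<noteq> 0"
    "\<And>x. x \<notin> K \<Longrightarrow> b x = 0"
proof -
  obtain r where r: "r > 0" "cball y r \<subseteq> W" using assms open_contains_cball by blast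
  define q where "q = (\<lambda>x. r\<^sup>2 - (x - y) \<bullet> (x - y))"
  have qeq: "q = (\<lambda>x. (r\<^sup>2 - y \<bullet> y + 2 * (x \<bullet> y)) + (-1) * (\<Sum>i\<in>Basis. (x \<bullet> i) * (x \<bullet> i)))"
    by (rule ext) (simp add: q_def inner_diff_left inner_diff_right inner_commute
        euclidean_inner[symmetric])
  have bl: "smooth_on (\<lambda>x. x \<bullet> z) UNIV" for z :: 'b
    by (intro smooth_on_bounded_linear bounded_linear_intros)
  have sm: "smooth_on (\<lambda>x. \<Sum>i\<in>Basis. (x \<bullet> i) * (x \<bullet> i)) (UNIV :: 'b set)"
    using smooth_on_mult[OF open_UNIV bl bl]
    by (auto simp: smooth_on_def intro!: times_differentiable_on_sum)
  have sq: "smooth_on q UNIV"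
    unfolding qeq by (intro smooth_on_add smooth_on_mult smooth_on_const bl sm open_UNIV)
  define b where "b = (\<lambda>x. flat_exp 1 (q x))"
  show ?thesis
  proof
    show "smooth_on b UNIV"
      unfolding b_def by (rule smooth_on_compose[where T=UNIV]) (use sq smooth_on_flat_exp in auto)
    show "compact (cball y r)" "cball y r \<subseteq> W" using r by auto
    show "b y \<noteq> 0" using r by (simp add: b_def flat_exp_def q_def)
    show "b x = 0" if "x \<notin> cball y r" for x
    proof -
      have "r < norm (x - y)" using that by (simp add: dist_norm norm_minus_commute)
      then have "r\<^sup>2 < (norm (x - y))\<^sup>2" using r by (intro power_strict_mono) auto
      then show ?thesis by (simp add: b_def flat_exp_def q_def power2_norm_eq_inner)
    qed
  qed
qed

section \<open>Fields and frames on a manifold\<close>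

lemma smooth_functions_iff:
  "f \<in> smooth_functions A \<longleftrightarrow>
     (\<forall>U c. (U, c) \<in> A \<longrightarrow> smooth_on (\<lambda>y. f (inv_into U c y)) (c ` U))"
  by (auto simp: smooth_functions_def comp_def)

locale smooth_manifold =
  fixes A :: "('a::{t2_space, second_countable_topology}, 'm::finite) atlas"
  assumes atlas: "smooth_atlas A"
begin

abbreviation "\<F> \<equiv> smooth_functions A"
abbreviation "\<X> \<equiv> vector_fields A"

lemma chart_open: "(U, c) \<in> A \<Longrightarrow> open U" "(U, c) \<in> A \<Longrightarrow> open (c ` U)"
  and chart_homeomorphism: "(U, c) \<in> A \<Longrightarrow> homeomorphism U (c ` U) c (inv_into U c)"
  and chart_change: "(U, c) \<in> A \<Longrightarrow> (V, d) \<in> A \<Longrightarrow>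
     smooth_on (\<lambda>y. d (inv_into U c y)) (c ` (U \<inter> V))"
  using atlas unfolding smooth_atlas_def comp_def by fast+

lemma chart_inv: "(U, c) \<in> A \<Longrightarrow> q \<in> U \<Longrightarrow> inv_into U c (c q) = q"
  using chart_homeomorphism by (metis homeomorphism_apply1)

lemma chart_image_open:
  assumes "(U, c) \<in> A" "open V" shows "open (c ` (U \<inter> V))"
proof -
  have "openin (top_of_set (c ` U)) (c ` (U \<inter> V))"
    using homeomorphism_imp_open_map[OF chart_homeomorphism[OF assms(1)], of "U \<inter> V"] assms(2)
    by (auto simp: openin_open)
  then show ?thesis using chart_open(2)[OF assms(1)] openin_open_trans by blast
qed

lemma chart_cover: obtains U c where "(U, c) \<in> A" "p \<in> U"
  using atlas unfolding smooth_atlas_def by fast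

lemma smooth_const [simp, intro]: "(\<lambda>_. r) \<in> \<F>"
  by (simp add: smooth_functions_iff smooth_on_const)

lemma smooth_0 [simp, intro]: "0 \<in> \<F>" and smooth_1 [simp, intro]: "1 \<in> \<F>"
  using smooth_const by (simp_all add: zero_fun_def one_fun_def)

lemma smooth_numeral [simp, intro]: "numeral k \<in> \<F>"
proof -
  have "(numeral k :: 'a \<Rightarrow> real) = (\<lambda>_. numeral k)"
    by (metis of_nat_fun of_nat_numeral)
  then show ?thesis by (simp only: smooth_const)
qed

lemma smooth_add [simp, intro]: "f \<in> \<F> \<Longrightarrow> h \<in> \<F> \<Longrightarrow> f + h \<in> \<F>"
  and smooth_mult [simp, intro]: "f \<in> \<F> \<Longrightarrow> h \<in> \<F> \<Longrightarrow> f * h \<in> \<F>"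
  by (auto simp: smooth_functions_iff plus_fun_def times_fun_def chart_open
      intro!: smooth_on_add smooth_on_mult)

lemma smooth_uminus [simp, intro]: "f \<in> \<F> \<Longrightarrow> - f \<in> \<F>"
  using smooth_mult[OF smooth_const[of "-1"], of f] by (simp add: times_fun_def fun_Compl_def)

lemma smooth_diff [simp, intro]: "f \<in> \<F> \<Longrightarrow> h \<in> \<F> \<Longrightarrow> f - h \<in> \<F>"
  using smooth_add[of f "- h"] by simp

lemma smooth_sum [simp, intro]: "(\<And>i. i \<in> I \<Longrightarrow> f i \<in> \<F>) \<Longrightarrow> (\<Sum>i\<in>I. f i) \<in> \<F>"
  by (induction I rule: infinite_finite_induct) auto

text \<open>
  A compact set is closed because the manifold is Hausdorff; so a function in a chart with compact
  support can be continued by \<open>0\<close>.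
\<close>
lemma extension_by_zero_smooth:
  assumes Uc: "(U, c) \<in> A" and F: "smooth_on F (c ` U)"
    and K: "compact K" "K \<subseteq> c ` U" "\<And>y. y \<in> c ` U \<Longrightarrow> y \<notin> K \<Longrightarrow> F y = 0"
  shows "(\<lambda>q. if q \<in> U then F (c q) else 0) \<in> \<F>"
  unfolding smooth_functions_iff
proof (intro allI impI)
  fix V d assume Vd: "(V, d) \<in> A"
  let ?i = "inv_into V d" and ?K = "inv_into U c ` K"
  let ?f = "\<lambda>y. if ?i y \<in> U then F (c (?i y)) else 0"
  have "continuous_on K (inv_into U c)"
    using chart_homeomorphism[OF Uc] K(2) continuous_on_subset by (auto simp: homeomorphism_def)
  then have "closed ?K" using K(1) compact_continuous_image compact_imp_closed by blast
  then have open2: "open (d ` (V \<inter> - ?K))" using chart_image_open[OF Vd] by auto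
  have open1: "open (d ` (V \<inter> U))" using chart_image_open[OF Vd] chart_open(1)[OF Uc] by auto
  have "smooth_on (\<lambda>y. F (c (?i y))) (d ` (V \<inter> U))"
    by (rule smooth_on_compose[OF open1 chart_open(2)[OF Uc] _ chart_change[OF Vd Uc] F])
      (auto simp: chart_inv[OF Vd])
  then have 1: "smooth_on ?f (d ` (V \<inter> U))"
    by (rule smooth_on_cong[OF open1, rotated]) (auto simp: chart_inv[OF Vd])
  have 2: "smooth_on ?f (d ` (V \<inter> - ?K))"
  proof (rule smooth_on_cong[OF open2 _ smooth_on_const[of 0]])
    fix y assume "y \<in> d ` (V \<inter> - ?K)"
    then obtain q where q: "y = d q" "q \<in> V" "q \<notin> ?K" by auto
    have "c q \<notin> K" if "q \<in> U" using q(3) chart_inv[OF Uc that] by (metis imageI)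
    then show "0 = ?f y" using q K(3) by (auto simp: chart_inv[OF Vd])
  qed
  have "?K \<subseteq> U" using K(2) by (auto intro: inv_into_into)
  then have "V = (V \<inter> U) \<union> (V \<inter> - ?K)" by blast
  then have "d ` V = d ` (V \<inter> U) \<union> d ` (V \<inter> - ?K)" by (metis image_Un)
  then show "smooth_on ?f (d ` V)" using smooth_on_Un[OF 1 2 open1 open2] by simp
qed


lemma tangent_0: "u \<in> tangent_space A p \<Longrightarrow> f \<notin> \<F> \<Longrightarrow> u f = 0"
  and tangent_mult: "u \<in> tangent_space A p \<Longrightarrow> f \<in> \<F> \<Longrightarrow> h \<in> \<F> \<Longrightarrow> u (f * h) = u f * h p + f p * u h"
  by (auto simp: tangent_space_def)

lemma tangent_linear: "u \<in> tangent_space A p \<Longrightarrow> f \<in> \<F> \<Longrightarrow> h \<in> \<F> \<Longrightarrow>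
   u (\<lambda>q. r * f q + s * h q) = r * u f + s * u h"
  by (auto simp: tangent_space_def)

lemma tangent_add: "u \<in> tangent_space A p \<Longrightarrow> f \<in> \<F> \<Longrightarrow> h \<in> \<F> \<Longrightarrow> u (f + h) = u f + u h"
  using tangent_linear[of u p f h 1 1] by (simp add: plus_fun_def)

lemma tangent_const: "u \<in> tangent_space A p \<Longrightarrow> u (\<lambda>_. r) = 0"
proof -
  assume u: "u \<in> tangent_space A p"
  have "u 1 = 0" using tangent_mult[OF u smooth_1 smooth_1] by simp
  then show ?thesis using tangent_linear[OF u smooth_1 smooth_1, of r 0] by simp
qed

lemma tangent_space_combination:
  "u \<in> tangent_space A p \<Longrightarrow> w \<in> tangent_space A p \<Longrightarrow> r *\<^sub>T u + s *\<^sub>T w \<in> tangent_space A p"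
  by (auto simp: tangent_space_def scale_tangent_def algebra_simps)

lemma tangent_subspace: "tangent.subspace (tangent_space A p)"
proof (rule tangent.subspaceI)
  show "0 \<in> tangent_space A p" by (auto simp: tangent_space_def)
  show "x + y \<in> tangent_space A p" if "x \<in> tangent_space A p" "y \<in> tangent_space A p" for x y
    using tangent_space_combination[OF that, of 1 1] by simp
  show "c *\<^sub>T x \<in> tangent_space A p" if "x \<in> tangent_space A p" for x c
    using tangent_space_combination[OF that that, of c 0] by simp
qed

lemma field_tangent [simp, intro]: "X \<in> \<X> \<Longrightarrow> X p \<in> tangent_space A p"
  and deriv_smooth [simp, intro]: "X \<in> \<X> \<Longrightarrow> f \<in> \<F> \<Longrightarrow> deriv_along X f \<in> \<F>"
  by (auto simp: vector_fields_def)

lemma field_add [simp, intro]: "X \<in> \<X> \<Longrightarrow> Y \<in> \<X> \<Longrightarrow> X + Y \<in> \<X>"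
  and field_scale [simp, intro]: "f \<in> \<F> \<Longrightarrow> X \<in> \<X> \<Longrightarrow> f *\<^sub>V X \<in> \<X>"
  and field_0 [simp, intro]: "0 \<in> \<X>"
proof -
  have eq: "deriv_along (X + Y) h = deriv_along X h + deriv_along Y h"
    "deriv_along (f *\<^sub>V X) h = f * deriv_along X h" "deriv_along 0 h = 0" for h f :: "'a \<Rightarrow> real" and X Y
    by (simp_all add: deriv_along_def scale_vfield_def scale_tangent_def fun_eq_iff)
  show "X + Y \<in> \<X>" if "X \<in> \<X>" "Y \<in> \<X>"
    unfolding vector_fields_def mem_Collect_eq eq plus_fun_apply[of X Y]
    using that by (intro conjI allI ballI tangent.subspace_add[OF tangent_subspace] smooth_add) simp_all
  show "f *\<^sub>V X \<in> \<X>" if "f \<in> \<F>" "X \<in> \<X>"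
    unfolding vector_fields_def mem_Collect_eq eq
    using that by (intro conjI allI ballI smooth_mult)
      (simp_all add: scale_vfield_def tangent.subspace_scale[OF tangent_subspace])
  show "0 \<in> \<X>"
    unfolding vector_fields_def mem_Collect_eq eq zero_fun_apply[where 'b="'a tangent"]
    using tangent.subspace_0[OF tangent_subspace] by simp
qed

text \<open>
  The coordinate field \<open>\<partial>\<^sub>i\<close> of a chart, multiplied by the cut-off function \<open>b\<close>, as a derivation.
\<close>
definition coordinate_field ::
  "'a set \<Rightarrow> ('a \<Rightarrow> real ^ 'm) \<Rightarrow> (real ^ 'm \<Rightarrow> real) \<Rightarrow> 'm \<Rightarrow> 'a vfield" where
  "coordinate_field U c b i = (\<lambda>q f. if q \<in> U \<and> f \<in> \<F> then
     b (c q) * frechet_derivative (f \<circ> inv_into U c) (at (c q)) (axis i 1) else 0)"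

lemma smooth_has_derivative:
  assumes "(U, c) \<in> A" "q \<in> U" "f \<in> \<F>"
  shows "((\<lambda>y. f (inv_into U c y)) has_derivative
    frechet_derivative (f \<circ> inv_into U c) (at (c q))) (at (c q))"
  using assms smooth_on_differentiable[of _ "c ` U" "c q"]
  by (auto simp: smooth_functions_def frechet_derivative_works[symmetric] comp_def)

lemma coordinate_field_in_fields:
  assumes Uc: "(U, c) \<in> A" and b: "smooth_on b UNIV"
    and K: "compact K" "K \<subseteq> c ` U" "\<And>y. y \<notin> K \<Longrightarrow> b y = 0"
  shows "coordinate_field U c b i \<in> \<X>"
proof -
  have "coordinate_field U c b i q \<in> tangent_space A q" for q
  proof (cases "q \<in> U")
    case False
    then show ?thesis
      by (auto simp: coordinate_field_def tangent_space_def)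
  next
    case q: True
    note d = smooth_has_derivative[OF Uc q]
    have sum: "frechet_derivative ((\<lambda>q. r * f q + s * h q) \<circ> inv_into U c) (at (c q)) v =
        r * frechet_derivative (f \<circ> inv_into U c) (at (c q)) v +
        s * frechet_derivative (h \<circ> inv_into U c) (at (c q)) v"
      if "f \<in> \<F>" "h \<in> \<F>" for f h r s v
    proof -
      have "((\<lambda>y. r * f (inv_into U c y) + s * h (inv_into U c y)) has_derivative
        (\<lambda>v. r * frechet_derivative (f \<circ> inv_into U c) (at (c q)) v +
          s * frechet_derivative (h \<circ> inv_into U c) (at (c q)) v)) (at (c q))"
        by (intro has_derivative_add has_derivative_mult_right d that)
      from frechet_derivative_at[OF this, symmetric] show ?thesis by (simp add: comp_def)
    qed
    have prod: "frechet_derivative ((f * h) \<circ> inv_into U c) (at (c q)) v =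
        frechet_derivative (f \<circ> inv_into U c) (at (c q)) v * h q +
        f q * frechet_derivative (h \<circ> inv_into U c) (at (c q)) v"
      if "f \<in> \<F>" "h \<in> \<F>" for f h v
    proof -
      have "((\<lambda>y. f (inv_into U c y) * h (inv_into U c y)) has_derivative
        (\<lambda>v. f (inv_into U c (c q)) * frechet_derivative (h \<circ> inv_into U c) (at (c q)) v +
          frechet_derivative (f \<circ> inv_into U c) (at (c q)) v * h (inv_into U c (c q)))) (at (c q))"
        by (intro has_derivative_mult d that)
      from frechet_derivative_at[OF this, symmetric] show ?thesis
        by (simp add: comp_def chart_inv[OF Uc q])
    qed
    have "(\<lambda>q. r * f q + s * h q) \<in> \<F>" if "f \<in> \<F>" "h \<in> \<F>" for f h r s
      using smooth_add[OF smooth_mult[OF smooth_const[of r] that(1)] smooth_mult[OF smooth_const[of s] that(2)]]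
      by (simp add: plus_fun_def times_fun_def)
    then show ?thesis using q
      by (auto simp: coordinate_field_def tangent_space_def sum prod algebra_simps)
  qed
  moreover have "deriv_along (coordinate_field U c b i) f \<in> \<F>" if f: "f \<in> \<F>" for f
  proof -
    let ?F = "\<lambda>y. b y * frechet_derivative (f \<circ> inv_into U c) (at y) (axis i 1)"
    have "smooth_on ?F (c ` U)"
      using f Uc smooth_on_subset[OF b] chart_open(2)[OF Uc]
      by (intro smooth_on_mult smooth_on_frechet_derivative) (auto simp: smooth_functions_def)
    then have "(\<lambda>q. if q \<in> U then ?F (c q) else 0) \<in> \<F>"
      by (rule extension_by_zero_smooth[OF Uc _ K(1,2)]) (simp add: K(3))
    then show ?thesis using f by (simp add: deriv_along_def coordinate_field_def)
  qed
  ultimately show ?thesis unfolding vector_fields_def by blast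
qed

end

text \<open>
  Otherwise one more vector could be added to \<open>C\<close>, against the bound on independent sets.
\<close>
lemma (in vector_space) independent_same_card_spans:
  assumes "finite B" "independent C" "C \<subseteq> span B" "card C = card B"
  shows "span C = span B"
proof
  show "span B \<subseteq> span C"
  proof (rule span_minimal[OF _ subspace_span], rule ccontr)
    assume "\<not> B \<subseteq> span C"
    then obtain x where x: "x \<in> B" "x \<notin> span C" by auto
    have C: "finite C" using independent_span_bound[OF assms(1-3)] by simp
    have "card (insert x C) \<le> card B"
      using independent_span_bound[OF assms(1), of "insert x C"] x assms(2,3) span_base
      by (auto simp: independent_insert)
    moreover have "x \<notin> C" using x(2) span_base by blast
    ultimately show False using C assms(4) by simp
  qed
qed (use assms(3) span_minimal subspace_span in blast)

text \<open>
  The dimension of the tangent spaces, as spaces of derivations, is a consequence of Hadamard's lemma. For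
  a pseudo-Riemannian manifold it is contained in the signature of the metric, and so it is an assumption here.
\<close>
locale manifold_of_dimension = smooth_manifold A
  for A :: "('a::{t2_space, second_countable_topology}, 'm::finite) atlas" +
  assumes tangent_basis_exists: "\<exists>b. tangent_basis A q b"
begin

lemma tangent_basis_if_independent:
  assumes "\<And>i. e i \<in> tangent_space A q" "inj e" "tangent.independent (range e)"
  shows "tangent_basis A q e"
proof -
  obtain b :: "'m \<Rightarrow> 'a tangent" where b: "inj b" "tangent.span (range b) = tangent_space A q"
    using tangent_basis_exists[of q] by (auto simp: tangent_basis_def)
  have "tangent.span (range e) = tangent.span (range b)"
    using assms b by (intro tangent.independent_same_card_spans) (auto simp: card_image)
  then show ?thesis using assms b by (simp add: tangent_basis_def)
qed

lemma tangent_basis_expand: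
  assumes "tangent_basis A q e" "u \<in> tangent_space A q"
  obtains a where "u = (\<Sum>i\<in>UNIV. a i *\<^sub>T e i)"
proof -
  have "u \<in> tangent.span (range e)" using assms by (simp add: tangent_basis_def)
  then obtain a where "u = (\<Sum>v\<in>range e. a v *\<^sub>T v)"
    using tangent.span_finite[of "range e"] by auto
  also have "\<dots> = (\<Sum>i\<in>UNIV. a (e i) *\<^sub>T e i)"
    using assms by (subst sum.reindex) (auto simp: tangent_basis_def)
  finally show ?thesis by (rule that)
qed

text \<open>
  Forms dual to \<open>e\<close>, up to a common factor, show the independence; the dimension does the rest.
\<close>
lemma tangent_basis_if_dual:
  assumes e: "\<And>i. e i \<in> tangent_space A q"
    and lin: "\<And>i u w r t. \<theta> i (r *\<^sub>T u + t *\<^sub>T w) = r * \<theta> i u + t * \<theta> i w"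
    and dual: "\<And>i j. \<theta> i (e j) = (if i = j then s else (0::real))" and s: "s \<noteq> 0"
  shows "tangent_basis A q e"
proof (rule tangent_basis_if_independent)
  have lin0: "\<theta> i 0 = 0" for i using lin[of i 0 0 0 0] by simp
  have sum: "\<theta> i (\<Sum>j\<in>J. a j *\<^sub>T e j) = (\<Sum>j\<in>J. a j * \<theta> i (e j))" for i a J
    using lin[of i _ _ 1] by (induction J rule: infinite_finite_induct) (auto simp: lin0 lin[of i _ _ 1, simplified])
  show inj: "inj e"
    using dual s by (metis injI)
  show "tangent.independent (range e)"
    apply (rule tangent.independent_if_scalars_zero)
     apply simp
    subgoal premises prems for a w
      proof -
        obtain i where i: "w = e i" using prems(2) by auto
        have "(\<Sum>j\<in>UNIV. a (e j) *\<^sub>T e j) = 0"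
          using prems(1) inj by (simp add: sum.reindex)
        then have "0 = (\<Sum>j\<in>UNIV. a (e j) * \<theta> i (e j))"
          using sum[of i "\<lambda>j. a (e j)" UNIV] lin0 by simp
        also have "\<dots> = a w * s"
          by (simp add: i dual if_distrib[of "\<lambda>x. _ * x"] cong: if_cong)
        finally show ?thesis using s by simp
      qed
    done
qed (rule e)

text \<open>
  A frame \<open>E\<close> and forms \<open>\<theta>\<close>, dual up to the cut-off factor \<open>s\<close>, all of them global. The expansion of a field
  and the duality are identities of global functions and fields, so they can be differentiated. The last
  condition makes both sides of a trace formula vanish where \<open>s\<close> does.
\<close>
definition cut_off_frame ::
  "('m \<Rightarrow> 'a vfield) \<Rightarrow> ('m \<Rightarrow> 'a one_form) \<Rightarrow> ('a \<Rightarrow> real) \<Rightarrow> bool" where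
  "cut_off_frame E \<theta> s \<longleftrightarrow>
     (\<forall>i. E i \<in> \<X>) \<and> s \<in> \<F> \<and>
     (\<forall>i q r t u w. \<theta> i q (r *\<^sub>T u + t *\<^sub>T w) = r * \<theta> i q u + t * \<theta> i q w) \<and>
     (\<forall>i. \<forall>X\<in>\<X>. eval1 (\<theta> i) X \<in> \<F>) \<and>
     (\<forall>X\<in>\<X>. s *\<^sub>V X = (\<Sum>i\<in>UNIV. eval1 (\<theta> i) X *\<^sub>V E i)) \<and>
     (\<forall>i j. eval1 (\<theta> i) (E j) = (if i = j then s else 0)) \<and>
     (\<forall>i q u. s q = 0 \<longrightarrow> \<theta> i q u = 0)"

lemma sum_scale_vfield_apply:
  "(\<Sum>i\<in>I. f i *\<^sub>V X i) q = (\<Sum>i\<in>I. f i q *\<^sub>T X i q)"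
  by (induction I rule: infinite_finite_induct) (auto simp: scale_vfield_def zero_fun_def plus_fun_def)

text \<open>
  For a cut-off function \<open>\<psi>\<close> in a chart, take \<open>E\<^sub>i = \<psi> \<partial>\<^sub>i\<close>, \<open>\<kappa>\<^sub>i = \<psi> x\<^sub>i\<close> and
  \<open>\<theta>\<^sub>i (X) = \<psi> X(\<kappa>\<^sub>i) - \<kappa>\<^sub>i X(\<psi>)\<close>. The derivatives of \<open>\<psi>\<close> cancel in \<open>\<theta>\<^sub>i (E\<^sub>j)\<close>, which is \<open>\<psi>^3\<close> for
  \<open>i = j\<close> and \<open>0\<close> otherwise.
\<close>
lemma cut_off_frame_exists:
  obtains E \<theta> s where "cut_off_frame E \<theta> s" "s p \<noteq> 0"
proof -
  obtain U c where Uc: "(U, c) \<in> A" "p \<in> U" by (rule chart_cover)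
  obtain b :: "real ^ 'm \<Rightarrow> real" and K where b: "smooth_on b UNIV" and K: "compact K" "K \<subseteq> c ` U" and bp: "b (c p) \<noteq> 0"
    and b0: "\<And>y. y \<notin> K \<Longrightarrow> b y = 0"
    by (rule smooth_bump_exists[OF chart_open(2)[OF Uc(1)] imageI[OF Uc(2)]]) blast
  define \<psi> where "\<psi> = (\<lambda>q. if q \<in> U then b (c q) else 0)"
  define \<kappa> where "\<kappa> = (\<lambda>i q. if q \<in> U then b (c q) * c q $ i else 0)"
  define E where "E = coordinate_field U c b"
  define \<theta> where "\<theta> = (\<lambda>i q (u :: 'a tangent). \<psi> q * u (\<kappa> i) - \<kappa> i q * u \<psi>)"
  define s where "s = \<psi> * \<psi> * \<psi>"
  have E: "E i \<in> \<X>" for i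
    unfolding E_def by (rule coordinate_field_in_fields[OF Uc(1) b K b0])
  have \<psi>: "\<psi> \<in> \<F>"
    unfolding \<psi>_def
    by (rule extension_by_zero_smooth[OF Uc(1) smooth_on_subset[OF b] K b0]) auto
  have coord: "smooth_on (\<lambda>y::real^'m. y $ i) S" for i S
    by (intro smooth_on_bounded_linear bounded_linear_vec_nth)
  have \<kappa>: "\<kappa> i \<in> \<F>" for i
    unfolding \<kappa>_def
    by (rule extension_by_zero_smooth[OF Uc(1)
          smooth_on_mult[OF chart_open(2)[OF Uc(1)] smooth_on_subset[OF b] coord] K]) (auto simp: b0)
  have dual_at: "\<theta> i q (E j q) = (if i = j then s q else 0)" for i j q
  proof (cases "q \<in> U")
    case False
    then show ?thesis by (simp add: \<theta>_def s_def \<psi>_def \<kappa>_def)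
  next
    case q: True
    let ?y = "c q" and ?D = "frechet_derivative b (at (c q))"
    have D: "(b has_derivative ?D) (at ?y)"
      using smooth_on_differentiable[OF b] by (simp add: frechet_derivative_works[symmetric])
    have D\<kappa>: "((\<lambda>y. b y * y $ i) has_derivative (\<lambda>v. b ?y * v $ i + ?D v * ?y $ i)) (at ?y)"
      by (intro has_derivative_mult D bounded_linear.has_derivative[OF bounded_linear_vec_nth] has_derivative_ident)
    have transfer: "frechet_derivative (f \<circ> inv_into U c) (at ?y) = G'"
      if "(G has_derivative G') (at ?y)" "\<And>q. q \<in> U \<Longrightarrow> f q = G (c q)" for f G G'
    proof -
      have "(f \<circ> inv_into U c has_derivative G') (at ?y)"
        by (rule has_derivative_transform_within_open[OF that(1) chart_open(2)[OF Uc(1)]])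
          (use q that(2) in \<open>auto simp: chart_inv[OF Uc(1)]\<close>)
      then show ?thesis by (rule frechet_derivative_at[symmetric])
    qed
    have "E j q \<psi> = b ?y * ?D (axis j 1)"
      using q \<psi> transfer[OF D, of \<psi>] by (simp add: E_def coordinate_field_def) (simp add: \<psi>_def)
    moreover have "E j q (\<kappa> i) = b ?y * (b ?y * (axis j 1 :: real^'m) $ i + ?D (axis j 1) * ?y $ i)"
      using q \<kappa>[of i] transfer[OF D\<kappa>, of "\<kappa> i"] by (simp add: E_def coordinate_field_def) (simp add: \<kappa>_def)
    ultimately show ?thesis using q
      by (simp add: \<theta>_def s_def \<psi>_def \<kappa>_def axis_def algebra_simps)
  qed
  have lin: "\<theta> i q (r *\<^sub>T u + t *\<^sub>T w) = r * \<theta> i q u + t * \<theta> i q w" for i q r t u w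
    by (simp add: \<theta>_def scale_tangent_def algebra_simps)
  have lin0: "\<theta> i q 0 = 0" for i q using lin[of i q 0 0 0 0] by simp
  have lin_sum: "\<theta> i q (\<Sum>j\<in>J. a j *\<^sub>T e j) = (\<Sum>j\<in>J. a j * \<theta> i q (e j))" for i q a J and e :: "'m \<Rightarrow> _"
    by (induction J rule: infinite_finite_induct)
      (simp_all only: lin0 sum.infinite sum.empty sum.insert not_False_eq_True
        lin[of i q _ _ 1, unfolded tangent.scale_one mult_1] if_True)
  have expand: "s *\<^sub>V X = (\<Sum>i\<in>UNIV. eval1 (\<theta> i) X *\<^sub>V E i)" if X: "X \<in> \<X>" for X
  proof
    fix q
    show "(s *\<^sub>V X) q = (\<Sum>i\<in>UNIV. eval1 (\<theta> i) X *\<^sub>V E i) q"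
    proof (cases "s q = 0")
      case True
      then have "\<psi> q = 0" by (simp add: s_def)
      moreover from this have "\<kappa> i q = 0" for i by (auto simp: \<kappa>_def \<psi>_def split: if_splits)
      ultimately show ?thesis
        unfolding sum_scale_vfield_apply
        by (simp add: scale_vfield_def True eval1_def \<theta>_def)
    next
      case False
      have "tangent_basis A q (\<lambda>i. E i q)"
        by (rule tangent_basis_if_dual[where \<theta>="\<lambda>i. \<theta> i q" and s="s q"])
          (use E False dual_at lin in auto)
      then obtain a where a: "X q = (\<Sum>i\<in>UNIV. a i *\<^sub>T E i q)"
        using tangent_basis_expand field_tangent[OF X] by metis
      have "\<theta> i q (X q) = a i * s q" for i
        unfolding a lin_sum by (simp add: dual_at if_distrib[of "\<lambda>x. _ * x"] cong: if_cong)
      then show ?thesis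
        unfolding sum_scale_vfield_apply
        by (simp add: scale_vfield_def eval1_def a tangent.scale_sum_right mult.commute)
    qed
  qed
  have "eval1 (\<theta> i) X = \<psi> * deriv_along X (\<kappa> i) - \<kappa> i * deriv_along X \<psi>" for i X
    by (simp add: eval1_def \<theta>_def deriv_along_def fun_eq_iff)
  then have smooth: "eval1 (\<theta> i) X \<in> \<F>" if "X \<in> \<X>" for i X
    using that \<psi> \<kappa> by simp
  have "s q = 0 \<longrightarrow> \<theta> i q u = 0" for i q u
    by (auto simp: s_def \<theta>_def \<kappa>_def \<psi>_def split: if_splits)
  then have "cut_off_frame E \<theta> s"
    unfolding cut_off_frame_def
    using E \<psi> lin smooth expand dual_at by (auto simp: s_def eval1_def fun_eq_iff)
  moreover have "s p \<noteq> 0" using Uc bp by (simp add: s_def \<psi>_def)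
  ultimately show ?thesis by (rule that)
qed

end

section \<open>The trace of a partial complex structure\<close>

lemma matrix_mult_minus:
  fixes A B :: "real ^ 'n ^ 'n"
  shows "A ** (- B) = - (A ** B)" "(- A) ** B = - (A ** B)"
  by (simp_all add: matrix_matrix_mult_def vec_eq_iff sum_negf)

lemma matrix_add_rdistrib:
  fixes A B C :: "real ^ 'n ^ 'n"
  shows "(A + B) ** C = A ** C + B ** C"
  by (simp add: matrix_matrix_mult_def vec_eq_iff sum.distrib distrib_right)

lemma transpose_add_minus:
  fixes A B :: "real ^ 'n ^ 'n"
  shows "transpose (A + B) = transpose A + transpose B" "transpose (- A) = - transpose A"
  by (simp_all add: transpose_def vec_eq_iff)

text \<open>
  The minimal polynomial divides \<open>X^3 + X\<close>, so the nonzero eigenvalues come in pairs \<open>\<plusminus>i\<close>.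
  An elementary argument: \<open>P = - F^2\<close> is the projection onto the part where \<open>F\<close> is a complex structure,
  and \<open>F\<close> is skew for the inner product with matrix \<open>S\<close>.
\<close>
lemma trace_cube_eq_minus_zero:
  fixes F :: "real ^ 'n ^ 'n"
  assumes "F ** F ** F = - F"
  shows "trace F = 0"
proof -
  let ?t = "transpose :: real^'n^'n \<Rightarrow> _"
  define P where "P = - (F ** F)"
  define Q where "Q = mat 1 + - P"
  define S where "S = ?t F ** F + ?t P ** P + ?t Q ** Q"
  have PF: "P ** F = F" using assms by (simp add: P_def matrix_mult_minus)
  have QF: "Q ** F = 0"
    using PF by (simp add: Q_def matrix_add_rdistrib matrix_mult_minus del: add_uminus_conv_diff)
  have FF: "F ** F = - P" by (simp add: P_def)
  have SF: "S ** F = ?t P ** F - ?t F ** P"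
    unfolding S_def matrix_add_rdistrib matrix_mul_assoc[symmetric] PF QF FF
    by (simp add: matrix_mult_minus)
  then have skew: "?t (S ** F) = - (S ** F)"
    by (simp add: diff_conv_add_uminus transpose_add_minus matrix_transpose_mul del: add_uminus_conv_diff)
  have St: "?t S = S"
    by (simp add: S_def transpose_add_minus matrix_transpose_mul)
  have "x = 0" if "S *v x = 0" for x
  proof -
    have n: "x \<bullet> ((?t M ** M) *v x) = (norm (M *v x))\<^sup>2" for M :: "real^'n^'n"
      by (simp add: matrix_vector_mul_assoc[symmetric] power2_norm_eq_inner
          dot_lmul_matrix inner_commute[of x] del: transpose_matrix_vector)
        (simp add: dot_lmul_matrix)
    have "0 = x \<bullet> (S *v x)" using that by simp
    also have "\<dots> = (norm (F *v x))\<^sup>2 + (norm (P *v x))\<^sup>2 + (norm (Q *v x))\<^sup>2"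
      by (simp add: S_def matrix_vector_mult_add_rdistrib inner_add_right n)
    finally have "norm (P *v x) = 0" "norm (Q *v x) = 0"
      by (simp_all add: add_nonneg_eq_0_iff)
    moreover have "x = P *v x + Q *v x"
      by (simp add: Q_def matrix_vector_mult_add_rdistrib[symmetric])
    ultimately show ?thesis by simp
  qed
  then obtain B where B: "B ** S = mat 1" using matrix_left_invertible_ker by blast
  then have SB: "S ** B = mat 1" by (simp add: matrix_left_right_inverse)
  have "S ** ?t B = mat 1" using B St by (metis matrix_transpose_mul transpose_mat)
  then have Bt: "?t B = B" by (metis B matrix_mul_assoc matrix_mul_lid matrix_mul_rid)
  have trt: "trace (?t M) = trace M" for M by (simp add: trace_def transpose_def)
  have "trace F = trace (B ** (S ** F))" by (simp add: matrix_mul_assoc B)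
  also have "\<dots> = trace (?t (B ** (S ** F)))" by (simp add: trt)
  also have "\<dots> = trace (- (S ** F) ** B)" by (simp only: matrix_transpose_mul[of B] skew Bt)
  also have "\<dots> = - trace (S ** F ** B)" by (simp add: matrix_mult_minus trace_def sum_negf)
  also have "\<dots> = - trace (B ** (S ** F))" by (simp only: trace_mul_sym[of "S ** F" B])
  also have "\<dots> = - trace F" by (simp add: matrix_mul_assoc B)
  finally show ?thesis by simp
qed

section \<open>Lie brackets\<close>

interpretation vfield: module scale_vfield
  by unfold_locales (auto simp: scale_vfield_def scale_tangent_def fun_eq_iff algebra_simps)

lemma vfield_scale_minus: "(- f) *\<^sub>V X = - (f *\<^sub>V X)" "(- 1) *\<^sub>V X = - X"
  by (auto simp: scale_vfield_def scale_tangent_def fun_eq_iff)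

context smooth_manifold
begin

lemma field_uminus [simp, intro]: "X \<in> \<X> \<Longrightarrow> - X \<in> \<X>"
  using field_scale[of "- 1" X] by (simp add: vfield_scale_minus)

lemma field_diff [simp, intro]: "X \<in> \<X> \<Longrightarrow> Y \<in> \<X> \<Longrightarrow> X - Y \<in> \<X>"
  using field_add[of X "- Y"] by simp

lemma field_sum [simp, intro]: "(\<And>i. i \<in> I \<Longrightarrow> X i \<in> \<X>) \<Longrightarrow> (\<Sum>i\<in>I. X i) \<in> \<X>"
  by (induction I rule: infinite_finite_induct) auto

lemma deriv_vfield [simp]:
  "deriv_along (X + Y) f = deriv_along X f + deriv_along Y f"
  "deriv_along (- X) f = - deriv_along X f"
  "deriv_along (X - Y) f = deriv_along X f - deriv_along Y f"
  "deriv_along (h *\<^sub>V X) f = h * deriv_along X f"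
  "deriv_along 0 f = 0"
  "deriv_along (lie_bracket X Y) f = deriv_along X (deriv_along Y f) - deriv_along Y (deriv_along X f)"
  by (simp_all add: deriv_along_def scale_vfield_def scale_tangent_def lie_bracket_def fun_eq_iff)

lemma deriv_add [simp]:
  "X \<in> \<X> \<Longrightarrow> f \<in> \<F> \<Longrightarrow> h \<in> \<F> \<Longrightarrow> deriv_along X (f + h) = deriv_along X f + deriv_along X h"
  by (simp add: deriv_along_def fun_eq_iff tangent_add[OF field_tangent])

lemma deriv_mult [simp]:
  "X \<in> \<X> \<Longrightarrow> f \<in> \<F> \<Longrightarrow> h \<in> \<F> \<Longrightarrow> deriv_along X (f * h) = deriv_along X f * h + f * deriv_along X h"
  by (simp add: deriv_along_def fun_eq_iff tangent_mult[OF field_tangent])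

lemma deriv_const [simp]: "X \<in> \<X> \<Longrightarrow> deriv_along X (\<lambda>_. r) = 0"
  by (simp add: deriv_along_def fun_eq_iff tangent_const[OF field_tangent])

lemma numeral_fun_const: "numeral k = (\<lambda>_::'a. numeral k :: real)"
  by (simp add: fun_eq_iff)

lemma deriv_0 [simp]: "X \<in> \<X> \<Longrightarrow> deriv_along X 0 = 0"
  and deriv_1 [simp]: "X \<in> \<X> \<Longrightarrow> deriv_along X 1 = 0"
  and deriv_numeral [simp]: "X \<in> \<X> \<Longrightarrow> deriv_along X (numeral k) = 0"
  using deriv_const[of X 0] deriv_const[of X 1] deriv_const[of X "numeral k"]
  by (simp_all only: numeral_fun_const zero_fun_def[symmetric] one_fun_def[symmetric])

lemma deriv_uminus [simp]: "X \<in> \<X> \<Longrightarrow> f \<in> \<F> \<Longrightarrow> deriv_along X (- f) = - deriv_along X f"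
  using deriv_add[of X f "- f"] by (simp add: eq_neg_iff_add_eq_0 add.commute del: deriv_add)

lemma deriv_diff [simp]:
  "X \<in> \<X> \<Longrightarrow> f \<in> \<F> \<Longrightarrow> h \<in> \<F> \<Longrightarrow> deriv_along X (f - h) = deriv_along X f - deriv_along X h"
  using deriv_add[of X f "- h"] by simp

lemma deriv_sum [simp]:
  "X \<in> \<X> \<Longrightarrow> (\<And>i. i \<in> I \<Longrightarrow> f i \<in> \<F>) \<Longrightarrow>
    deriv_along X (\<Sum>i\<in>I. f i) = (\<Sum>i\<in>I. deriv_along X (f i))"
  by (induction I rule: infinite_finite_induct) auto

text \<open>
  By this lemma the identities of the bracket follow from those of the commutator of derivations.
\<close>
lemma field_eqI:
  assumes "X \<in> \<X>" "Y \<in> \<X>" "\<And>f. f \<in> \<F> \<Longrightarrow> deriv_along X f = deriv_along Y f"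
  shows "X = Y"
proof (intro ext)
  fix p f
  show "X p f = Y p f"
    using tangent_0[OF field_tangent[OF assms(1)], of f p] tangent_0[OF field_tangent[OF assms(2)], of f p]
      fun_cong[OF assms(3), of f p]
    by (cases "f \<in> \<F>") (simp_all add: deriv_along_def)
qed

lemma bracket_field [simp, intro]:
  assumes "X \<in> \<X>" "Y \<in> \<X>" shows "lie_bracket X Y \<in> \<X>"
proof -
  have lin: "Z p (\<lambda>q. r * f q + s * h q) = r * Z p f + s * Z p h"
    if "Z \<in> \<X>" "f \<in> \<F>" "h \<in> \<F>" for Z p r f s h
    using tangent_linear[OF field_tangent] that by simp
  have dlin: "deriv_along Z (\<lambda>q. r * f q + s * h q) = (\<lambda>q. r * deriv_along Z f q + s * deriv_along Z h q)"
    if "Z \<in> \<X>" "f \<in> \<F>" "h \<in> \<F>" for Z r f s h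
    using lin that by (simp add: deriv_along_def)
  have "lie_bracket X Y p \<in> tangent_space A p" for p
    unfolding tangent_space_def mem_Collect_eq
  proof (intro conjI ballI allI impI)
    fix f h r s assume "f \<in> \<F>" "h \<in> \<F>"
    then show "lie_bracket X Y p (\<lambda>q. r * f q + s * h q) = r * lie_bracket X Y p f + s * lie_bracket X Y p h"
      using assms by (simp add: lie_bracket_def dlin lin algebra_simps)
  next
    fix f h assume "f \<in> \<F>" "h \<in> \<F>"
    then have "deriv_along (lie_bracket X Y) (f * h) =
        deriv_along (lie_bracket X Y) f * h + f * deriv_along (lie_bracket X Y) h"
      using assms by (simp add: algebra_simps)
    from fun_cong[OF this, of p]
    show "lie_bracket X Y p (f * h) = lie_bracket X Y p f * h p + f p * lie_bracket X Y p h"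
      by (simp only: deriv_along_def plus_fun_apply times_fun_apply)
  next
    fix f assume "f \<notin> \<F>"
    then have "deriv_along Z f = 0" if "Z \<in> \<X>" for Z
      using that tangent_0[OF field_tangent] by (simp add: deriv_along_def fun_eq_iff)
    moreover have "Z p 0 = 0" if "Z \<in> \<X>" for Z
      using fun_cong[OF deriv_0[OF that], of p] by (simp add: deriv_along_def)
    ultimately have "deriv_along X f = 0" "deriv_along Y f = 0" "X p 0 = 0" "Y p 0 = 0"
      using assms by auto
    then show "lie_bracket X Y p f = 0" by (simp only: lie_bracket_def diff_self)
  qed
  moreover have "deriv_along (lie_bracket X Y) f \<in> \<F>" if "f \<in> \<F>" for f
    using assms that by simp
  ultimately show ?thesis unfolding vector_fields_def by blast
qed

lemma bracket_add:
  "X \<in> \<X> \<Longrightarrow> Y \<in> \<X> \<Longrightarrow> Z \<in> \<X> \<Longrightarrow> lie_bracket X (Y + Z) = lie_bracket X Y + lie_bracket X Z"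
  "X \<in> \<X> \<Longrightarrow> Y \<in> \<X> \<Longrightarrow> Z \<in> \<X> \<Longrightarrow> lie_bracket (X + Y) Z = lie_bracket X Z + lie_bracket Y Z"
  by (rule field_eqI; simp add: algebra_simps)+

lemma bracket_diff:
  "X \<in> \<X> \<Longrightarrow> Y \<in> \<X> \<Longrightarrow> Z \<in> \<X> \<Longrightarrow> lie_bracket X (Y - Z) = lie_bracket X Y - lie_bracket X Z"
  "X \<in> \<X> \<Longrightarrow> Y \<in> \<X> \<Longrightarrow> Z \<in> \<X> \<Longrightarrow> lie_bracket (X - Y) Z = lie_bracket X Z - lie_bracket Y Z"
  by (rule field_eqI; simp add: algebra_simps)+

lemma bracket_scale:
  "X \<in> \<X> \<Longrightarrow> Y \<in> \<X> \<Longrightarrow> f \<in> \<F> \<Longrightarrow>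
    lie_bracket X (f *\<^sub>V Y) = deriv_along X f *\<^sub>V Y + f *\<^sub>V lie_bracket X Y"
  "X \<in> \<X> \<Longrightarrow> Y \<in> \<X> \<Longrightarrow> f \<in> \<F> \<Longrightarrow>
    lie_bracket (f *\<^sub>V X) Y = f *\<^sub>V lie_bracket X Y - deriv_along Y f *\<^sub>V X"
  by (rule field_eqI; simp add: algebra_simps)+

lemma bracket_antisym: "lie_bracket X Y = - lie_bracket Y X"
  by (simp add: lie_bracket_def fun_eq_iff)

lemma bracket_0: "X \<in> \<X> \<Longrightarrow> lie_bracket X 0 = 0"
  using bracket_diff(1)[of X 0 0] by simp

lemma bracket_sum: "X \<in> \<X> \<Longrightarrow> (\<And>i. i \<in> I \<Longrightarrow> Y i \<in> \<X>) \<Longrightarrow>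
    lie_bracket X (\<Sum>i\<in>I. Y i) = (\<Sum>i\<in>I. lie_bracket X (Y i))"
  by (induction I rule: infinite_finite_induct) (auto simp: bracket_0 bracket_add)

lemma jacobi: "X \<in> \<X> \<Longrightarrow> Y \<in> \<X> \<Longrightarrow> Z \<in> \<X> \<Longrightarrow>
    lie_bracket X (lie_bracket Y Z) = lie_bracket (lie_bracket X Y) Z + lie_bracket Y (lie_bracket X Z)"
  by (rule field_eqI; simp)

definition field_linear :: "('a vfield \<Rightarrow> 'a vfield) \<Rightarrow> bool" where
  "field_linear T \<longleftrightarrow> (\<forall>X\<in>\<X>. T X \<in> \<X>) \<and> (\<forall>X\<in>\<X>. \<forall>Y\<in>\<X>. T (X + Y) = T X + T Y) \<and>
     (\<forall>f\<in>\<F>. \<forall>X\<in>\<X>. T (f *\<^sub>V X) = f *\<^sub>V T X)"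

lemma field_linearD:
  assumes "field_linear T"
  shows "X \<in> \<X> \<Longrightarrow> T X \<in> \<X>" "X \<in> \<X> \<Longrightarrow> Y \<in> \<X> \<Longrightarrow> T (X + Y) = T X + T Y"
    "f \<in> \<F> \<Longrightarrow> X \<in> \<X> \<Longrightarrow> T (f *\<^sub>V X) = f *\<^sub>V T X"
  using assms unfolding field_linear_def by blast+

definition form_linear :: "('a vfield \<Rightarrow> 'a \<Rightarrow> real) \<Rightarrow> bool" where
  "form_linear \<alpha> \<longleftrightarrow> (\<forall>X\<in>\<X>. \<forall>Y\<in>\<X>. \<alpha> (X + Y) = \<alpha> X + \<alpha> Y) \<and>
     (\<forall>f\<in>\<F>. \<forall>X\<in>\<X>. \<alpha> (f *\<^sub>V X) = f * \<alpha> X)"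

lemma form_linearD:
  assumes "form_linear \<alpha>"
  shows "X \<in> \<X> \<Longrightarrow> Y \<in> \<X> \<Longrightarrow> \<alpha> (X + Y) = \<alpha> X + \<alpha> Y"
    "f \<in> \<F> \<Longrightarrow> X \<in> \<X> \<Longrightarrow> \<alpha> (f *\<^sub>V X) = f * \<alpha> X"
  using assms unfolding form_linear_def by blast+

lemma field_linear_sum:
  assumes "field_linear T" "\<And>i. i \<in> I \<Longrightarrow> f i \<in> \<F>" "\<And>i. i \<in> I \<Longrightarrow> X i \<in> \<X>"
  shows "T (\<Sum>i\<in>I. f i *\<^sub>V X i) = (\<Sum>i\<in>I. f i *\<^sub>V T (X i))"
proof -
  have "T (0 + 0) = T 0 + T 0" by (rule field_linearD(2)[OF assms(1) field_0 field_0])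
  then have "T 0 = 0" by simp
  with assms(2,3) show ?thesis
  proof (induction I rule: infinite_finite_induct)
    case (insert i I)
    then have "T (f i *\<^sub>V X i + (\<Sum>i\<in>I. f i *\<^sub>V X i)) = T (f i *\<^sub>V X i) + T (\<Sum>i\<in>I. f i *\<^sub>V X i)"
      by (intro field_linearD(2)[OF assms(1)] field_scale field_sum) auto
    with insert show ?case by (simp add: field_linearD(3)[OF assms(1)] del: plus_fun_apply zero_fun_apply times_fun_apply)
  qed (simp_all only: sum.infinite sum.empty not_False_eq_True)
qed

lemma form_linear_sum:
  assumes "form_linear \<alpha>" "\<And>i. i \<in> I \<Longrightarrow> f i \<in> \<F>" "\<And>i. i \<in> I \<Longrightarrow> X i \<in> \<X>"
  shows "\<alpha> (\<Sum>i\<in>I. f i *\<^sub>V X i) = (\<Sum>i\<in>I. f i * \<alpha> (X i))"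
proof -
  have "\<alpha> (0 + 0) = \<alpha> 0 + \<alpha> 0" by (rule form_linearD(1)[OF assms(1) field_0 field_0])
  then have "\<alpha> 0 = 0" by simp
  with assms(2,3) show ?thesis
  proof (induction I rule: infinite_finite_induct)
    case (insert i I)
    then have "\<alpha> (f i *\<^sub>V X i + (\<Sum>i\<in>I. f i *\<^sub>V X i)) = \<alpha> (f i *\<^sub>V X i) + \<alpha> (\<Sum>i\<in>I. f i *\<^sub>V X i)"
      by (intro form_linearD(1)[OF assms(1)] field_scale field_sum) auto
    with insert show ?case by (simp add: form_linearD(2)[OF assms(1)] del: plus_fun_apply zero_fun_apply times_fun_apply)
  qed (simp_all only: sum.infinite sum.empty not_False_eq_True)
qed

end

section \<open>Pseudo-Riemannian metrics and traces\<close>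

text \<open>
  From here on functions are elements of a commutative ring; they are evaluated at points on demand only.
\<close>
lemmas fun_apply = plus_fun_apply zero_fun_apply times_fun_apply one_fun_apply
  minus_apply uminus_apply numeral_fun_apply

lemma sum_fun_apply: "(\<Sum>i\<in>I. f i) x = (\<Sum>i\<in>I. f i x)" for f :: "_ \<Rightarrow> 'b \<Rightarrow> real"
  by (induction I rule: infinite_finite_induct) auto

declare fun_apply [simp del]

lemma (in manifold_of_dimension) cut_off_frameD:
  assumes "cut_off_frame E \<theta> s"
  shows "E i \<in> \<X>" "s \<in> \<F>" "\<theta> i q (r *\<^sub>T u + t *\<^sub>T w) = r * \<theta> i q u + t * \<theta> i q w"
    "X \<in> \<X> \<Longrightarrow> eval1 (\<theta> i) X \<in> \<F>"
    "X \<in> \<X> \<Longrightarrow> s *\<^sub>V X = (\<Sum>i\<in>UNIV. eval1 (\<theta> i) X *\<^sub>V E i)"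
    "eval1 (\<theta> i) (E j) = (if i = j then s else 0)"
    "s q = 0 \<Longrightarrow> \<theta> i q u = 0"
  using assms unfolding cut_off_frame_def by blast+

lemma (in manifold_of_dimension) frame_form_sum:
  assumes "cut_off_frame E \<theta> s"
  shows "\<theta> i q (\<Sum>j\<in>J. a j *\<^sub>T e j) = (\<Sum>j\<in>J. a j * \<theta> i q (e j))"
proof -
  note lin = cut_off_frameD(3)[OF assms]
  have "\<theta> i q 0 = 0" using lin[of i q 0 0 0 0] by simp
  then show ?thesis
    by (induction J rule: infinite_finite_induct)
      (simp_all only: sum.infinite sum.empty sum.insert not_False_eq_True
        lin[of i q _ _ 1, unfolded tangent.scale_one mult_1] if_True)
qed

lemma (in manifold_of_dimension) frame_form_linear:
  assumes "cut_off_frame E \<theta> s"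
  shows "form_linear (eval1 (\<theta> i))"
proof -
  note lin = cut_off_frameD(3)[OF assms]
  have "\<theta> i q (u + w) = \<theta> i q u + \<theta> i q w" "\<theta> i q (r *\<^sub>T u) = r * \<theta> i q u" for q r u w
    using lin[of i q 1 u 1 w] lin[of i q r u 0 u] by simp_all
  then show ?thesis
    by (simp add: form_linear_def eval1_def scale_vfield_def fun_eq_iff fun_apply)
qed

lemma (in manifold_of_dimension) frame_contraction:
  assumes fr: "cut_off_frame E \<theta> s" and \<alpha>: "form_linear \<alpha>" and X: "X \<in> \<X>"
  shows "(\<Sum>i\<in>UNIV. eval1 (\<theta> i) X * \<alpha> (E i)) = s * \<alpha> X"
proof -
  note fr = cut_off_frameD[OF fr]
  have "s * \<alpha> X = \<alpha> (s *\<^sub>V X)" using form_linearD(2)[OF \<alpha>] fr(2) X by simp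
  also have "\<dots> = (\<Sum>i\<in>UNIV. eval1 (\<theta> i) X * \<alpha> (E i))"
    unfolding fr(5)[OF X] by (rule form_linear_sum[OF \<alpha>]) (use fr X in auto)
  finally show ?thesis by simp
qed

lemma (in manifold_of_dimension) frame_expand_image:
  assumes fr: "cut_off_frame E \<theta> s" and T: "field_linear T" and X: "X \<in> \<X>"
  shows "s *\<^sub>V T X = (\<Sum>i\<in>UNIV. eval1 (\<theta> i) X *\<^sub>V T (E i))"
proof -
  note fr = cut_off_frameD[OF fr]
  have "s *\<^sub>V T X = T (s *\<^sub>V X)" using field_linearD(3)[OF T] fr(2) X by simp
  also have "\<dots> = (\<Sum>i\<in>UNIV. eval1 (\<theta> i) X *\<^sub>V T (E i))"
    unfolding fr(5)[OF X] by (rule field_linear_sum[OF T]) (use fr X in auto)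
  finally show ?thesis .
qed

lemma (in manifold_of_dimension) frame_basis_at:
  assumes fr: "cut_off_frame E \<theta> s" and s: "s q \<noteq> 0"
  shows "frame_at A q E"
proof -
  note fr = cut_off_frameD[OF fr]
  have d: "\<theta> i q (E j q) = (if i = j then s q else 0)" for i j
    using fun_cong[OF fr(6)[of i j], of q] by (auto simp: eval1_def fun_apply split: if_splits)
  have "tangent_basis A q (\<lambda>i. E i q)"
    by (rule tangent_basis_if_dual[where \<theta>="\<lambda>i. \<theta> i q" and s="s q"])
      (use fr(1,3) s d in auto)
  then show ?thesis using fr(1) by (simp add: frame_at_def)
qed

text \<open>
  Hence the Ricci tensor is computed in an actual frame at each point.
\<close>
lemma (in manifold_of_dimension) frame_at_exists: "\<exists>e. frame_at A p e"
  using cut_off_frame_exists frame_basis_at by metis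

lemma (in manifold_of_dimension) field_through_vector:
  assumes "u \<in> tangent_space A p"
  obtains X where "X \<in> \<X>" "X p = u"
proof -
  obtain e where e: "\<And>i. e i \<in> \<X>" "tangent_basis A p (\<lambda>i. e i p)"
    using frame_at_exists[of p] by (auto simp: frame_at_def)
  obtain a where a: "u = (\<Sum>i\<in>UNIV. a i *\<^sub>T e i p)"
    using tangent_basis_expand[OF e(2) assms] .
  show ?thesis
    by (rule that[of "\<Sum>i\<in>UNIV. (\<lambda>_. a i) *\<^sub>V e i"])
      (use e(1) a sum_scale_vfield_apply[of "\<lambda>i _. a i" e UNIV p] in auto)
qed

text \<open>
  An endomorphism \<open>T\<close> with \<open>T^3 = - T\<close> is traceless: its matrix in a frame has the same property.
\<close>
lemma (in manifold_of_dimension) frame_trace_cube_eq_minus: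
  assumes fr: "cut_off_frame E \<theta> s" and T: "field_linear T"
    and cube: "\<And>X. X \<in> \<X> \<Longrightarrow> T (T (T X)) = - T X"
  shows "(\<Sum>i\<in>UNIV. eval1 (\<theta> i) (T (E i))) = 0"
proof
  fix q
  note frD = cut_off_frameD[OF fr]
  note TX = field_linearD(1)[OF T]
  show "(\<Sum>i\<in>UNIV. eval1 (\<theta> i) (T (E i))) q = 0 q"
  proof (cases "s q = 0")
    case True
    then have "eval1 (\<theta> i) X q = 0" for i X
      using frD(7) by (simp add: eval1_def)
    then show ?thesis by (simp add: sum_fun_apply fun_apply)
  next
    case False
    define M where "M S = (\<chi> i j. eval1 (\<theta> i) (S (E j)) q / s q)" for S :: "'a vfield \<Rightarrow> 'a vfield"
    have comp: "M (\<lambda>X. S (T X)) = M S ** M T" if S: "field_linear S" for S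
    proof -
      have "s * eval1 (\<theta> i) (S (T (E j))) = (\<Sum>k\<in>UNIV. eval1 (\<theta> i) (S (E k)) * eval1 (\<theta> k) (T (E j)))" for i j
      proof -
        have "form_linear (\<lambda>X. eval1 (\<theta> i) (S X))"
          using form_linearD[OF frame_form_linear[OF fr]] field_linearD[OF S]
          unfolding form_linear_def by simp
        from frame_contraction[OF fr this TX[OF frD(1)]] show ?thesis by (simp add: mult.commute)
      qed
      then have "s q * eval1 (\<theta> i) (S (T (E j))) q =
          (\<Sum>k\<in>UNIV. eval1 (\<theta> i) (S (E k)) q * eval1 (\<theta> k) (T (E j)) q)" for i j
        by (metis (no_types, lifting) sum.cong sum_fun_apply times_fun_apply)
      then show ?thesis using False
        by (simp add: M_def vec_eq_iff matrix_matrix_mult_def sum_divide_distrib[symmetric] field_simps)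
    qed
    have TT: "field_linear (\<lambda>X. T (T X))" using field_linearD[OF T] by (simp add: field_linear_def)
    have "M T ** M T ** M T = M (\<lambda>X. T (T (T X)))"
      using comp[OF T] comp[OF TT] by simp
    also have "\<dots> = - M T"
    proof -
      have neg: "eval1 (\<theta> i) (- X) q = - eval1 (\<theta> i) X q" if "X \<in> \<X>" for i X
        using form_linearD(2)[OF frame_form_linear[OF fr], of "- 1" X] that
        by (simp add: vfield_scale_minus fun_apply)
      show ?thesis using frD(1) TX by (simp add: M_def vec_eq_iff cube neg)
    qed
    finally have "trace (M T) = 0" by (rule trace_cube_eq_minus_zero)
    then show ?thesis using False
      by (simp add: trace_def M_def sum_divide_distrib[symmetric] sum_fun_apply fun_apply)
  qed
qed

locale pseudo_riemannian_manifold = smooth_manifold A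
  for A :: "('a::{t2_space, second_countable_topology}, 'm::finite) atlas" +
  fixes g :: "'a bilinear_field" and k l :: nat
  assumes metric: "pseudo_riemannian_metric A k l g"

sublocale pseudo_riemannian_manifold \<subseteq> manifold_of_dimension
  using metric by unfold_locales (auto simp: pseudo_riemannian_metric_def)

context pseudo_riemannian_manifold
begin

abbreviation "G \<equiv> eval2 g"

lemma g_sym: "u \<in> tangent_space A p \<Longrightarrow> w \<in> tangent_space A p \<Longrightarrow> g p u w = g p w u"
  and g_left: "u \<in> tangent_space A p \<Longrightarrow> w \<in> tangent_space A p \<Longrightarrow> z \<in> tangent_space A p \<Longrightarrow>
     g p (r *\<^sub>T u + t *\<^sub>T w) z = r * g p u z + t * g p w z"
  and G_smooth [simp, intro]: "X \<in> \<X> \<Longrightarrow> Y \<in> \<X> \<Longrightarrow> G X Y \<in> \<F>"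
  using metric unfolding pseudo_riemannian_metric_def smooth_symmetric_bilinear_def by blast+

lemma G_commute: "X \<in> \<X> \<Longrightarrow> Y \<in> \<X> \<Longrightarrow> G X Y = G Y X"
  by (simp add: eval2_def g_sym[OF field_tangent field_tangent])

lemma G_add:
  "X \<in> \<X> \<Longrightarrow> Y \<in> \<X> \<Longrightarrow> Z \<in> \<X> \<Longrightarrow> G (X + Y) Z = G X Z + G Y Z"
  "X \<in> \<X> \<Longrightarrow> Y \<in> \<X> \<Longrightarrow> Z \<in> \<X> \<Longrightarrow> G Z (X + Y) = G Z X + G Z Y"
proof -
  show *: "G (X + Y) Z = G X Z + G Y Z" if "X \<in> \<X>" "Y \<in> \<X>" "Z \<in> \<X>" for X Y Z
    using g_left[OF field_tangent[OF that(1)] field_tangent[OF that(2)] field_tangent[OF that(3)], of _ 1 1]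
    by (simp add: eval2_def fun_eq_iff fun_apply)
  show "X \<in> \<X> \<Longrightarrow> Y \<in> \<X> \<Longrightarrow> Z \<in> \<X> \<Longrightarrow> G Z (X + Y) = G Z X + G Z Y"
    using *[of X Y Z] by (simp add: G_commute[of Z])
qed

lemma G_scale:
  "f \<in> \<F> \<Longrightarrow> X \<in> \<X> \<Longrightarrow> Z \<in> \<X> \<Longrightarrow> G (f *\<^sub>V X) Z = f * G X Z"
  "f \<in> \<F> \<Longrightarrow> X \<in> \<X> \<Longrightarrow> Z \<in> \<X> \<Longrightarrow> G Z (f *\<^sub>V X) = f * G Z X"
proof -
  show *: "G (f *\<^sub>V X) Z = f * G X Z" if "f \<in> \<F>" "X \<in> \<X>" "Z \<in> \<X>" for f X Z
    using g_left[OF field_tangent[OF that(2)] field_tangent[OF that(2)] field_tangent[OF that(3)], of _ _ 0]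
    by (simp add: eval2_def scale_vfield_def fun_eq_iff fun_apply)
  show "f \<in> \<F> \<Longrightarrow> X \<in> \<X> \<Longrightarrow> Z \<in> \<X> \<Longrightarrow> G Z (f *\<^sub>V X) = f * G Z X"
    using *[of f X Z] by (simp add: G_commute[of Z])
qed

lemma G_uminus: "X \<in> \<X> \<Longrightarrow> Z \<in> \<X> \<Longrightarrow> G (- X) Z = - G X Z" "X \<in> \<X> \<Longrightarrow> Z \<in> \<X> \<Longrightarrow> G Z (- X) = - G Z X"
  using G_scale[of "- 1" X Z] by (simp_all add: vfield_scale_minus)

lemma G_diff:
  "X \<in> \<X> \<Longrightarrow> Y \<in> \<X> \<Longrightarrow> Z \<in> \<X> \<Longrightarrow> G (X - Y) Z = G X Z - G Y Z"
  "X \<in> \<X> \<Longrightarrow> Y \<in> \<X> \<Longrightarrow> Z \<in> \<X> \<Longrightarrow> G Z (X - Y) = G Z X - G Z Y"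
  using G_add[of X "- Y" Z] by (simp_all add: G_uminus)

lemma G_0: "Z \<in> \<X> \<Longrightarrow> G 0 Z = 0" "Z \<in> \<X> \<Longrightarrow> G Z 0 = 0"
  using G_diff[of 0 0 Z] by simp_all

lemmas G_linear = G_add G_scale G_uminus G_diff G_0

lemma g_sum:
  assumes "\<And>i. i \<in> I \<Longrightarrow> e i \<in> tangent_space A p" "w \<in> tangent_space A p"
  shows "g p (\<Sum>i\<in>I. a i *\<^sub>T e i) w = (\<Sum>i\<in>I. a i * g p (e i) w)"
proof -
  have 0: "g p 0 w = 0"
    using g_left[OF assms(2) assms(2) assms(2), of 0 0] by simp
  show ?thesis using assms(1)
  proof (induction I rule: infinite_finite_induct)
    case (insert i I)
    have "(\<Sum>i\<in>I. a i *\<^sub>T e i) \<in> tangent_space A p"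
      using insert by (intro tangent.subspace_sum[OF tangent_subspace] tangent.subspace_scale[OF tangent_subspace]) auto
    then show ?case
      using insert g_left[of "e i" p "\<Sum>i\<in>I. a i *\<^sub>T e i" w "a i" 1] assms(2) by simp
  qed (simp_all add: 0)
qed

lemma g_nondegenerate:
  assumes u: "u \<in> tangent_space A p" and orth: "\<And>w. w \<in> tangent_space A p \<Longrightarrow> g p u w = 0"
  shows "u = 0"
proof -
  obtain e P where e: "tangent_basis A p e"
    and o: "\<And>i j. g p (e i) (e j) = (if i \<noteq> j then 0 else if i \<in> P then 1 else - 1)"
    using metric unfolding pseudo_riemannian_metric_def by metis
  have et: "e i \<in> tangent_space A p" for i
    using e tangent.span_base[of "e i" "range e"] by (simp add: tangent_basis_def)
  obtain a where a: "u = (\<Sum>i\<in>UNIV. a i *\<^sub>T e i)" using tangent_basis_expand[OF e u] .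
  have "a j = 0" for j
  proof -
    have "0 = (\<Sum>i\<in>UNIV. a i * g p (e i) (e j))"
      using orth[OF et[of j]] g_sum[of UNIV e p "e j" a] et by (simp add: a)
    also have "\<dots> = (\<Sum>i\<in>UNIV. if i = j then a j * (if j \<in> P then 1 else -1) else 0)"
      by (rule sum.cong) (auto simp: o)
    also have "\<dots> = a j * (if j \<in> P then 1 else - 1)" by simp
    finally show ?thesis by (simp split: if_splits)
  qed
  then show ?thesis by (simp add: a)
qed

text \<open>
  It suffices to test with global fields, as every tangent vector is a value of such a field.
\<close>
lemma G_nondegenerate:
  assumes "X \<in> \<X>" "\<And>Y. Y \<in> \<X> \<Longrightarrow> G X Y = 0"
  shows "X = 0"
proof
  fix p
  show "X p = 0 p"
    unfolding zero_fun_apply[of p]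
  proof (rule g_nondegenerate[OF field_tangent[OF assms(1)]])
    fix w assume "w \<in> tangent_space A p"
    then obtain Y where Y: "Y \<in> \<X>" "Y p = w" by (rule field_through_vector)
    show "g p (X p) w = 0"
      using fun_cong[OF assms(2)[OF Y(1)], of p] Y(2) by (simp add: eval2_def fun_apply)
  qed
qed

text \<open>
  The metric trace with respect to any basis at \<open>q\<close> is the trace of the endomorphism. It is compared
  here with the trace computed in a frame that does not depend on \<open>q\<close>.
\<close>
lemma metric_trace_eq_frame_trace:
  assumes fr: "cut_off_frame E \<theta> s" and T: "field_linear T" and e: "frame_at A q e"
  shows "s q * (\<Sum>i\<in>UNIV. \<Sum>j\<in>UNIV. matrix_inv (\<chi> a b. g q (e a q) (e b q)) $ i $ j * G (T (e i)) (e j) q) =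
    (\<Sum>k\<in>UNIV. eval1 (\<theta> k) (T (E k)) q)"
proof -
  note frD = cut_off_frameD[OF fr]
  note TX = field_linearD(1)[OF T]
  have eX: "e i \<in> \<X>" and eb: "tangent_basis A q (\<lambda>i. e i q)" for i
    using e by (auto simp: frame_at_def)
  define M where "M = (\<chi> a b. g q (e a q) (e b q))"
  have Msym: "M $ i $ j = M $ j $ i" for i j
    using g_sym[OF field_tangent[OF eX] field_tangent[OF eX]] by (simp add: M_def)
  have "x = 0" if "M *v x = 0" for x
  proof -
    have orth: "g q (\<Sum>i\<in>UNIV. x $ i *\<^sub>T e i q) (e j q) = 0" for j
    proof -
      have "(\<Sum>i\<in>UNIV. M $ j $ i * x $ i) = 0"
        using that by (simp add: matrix_vector_mult_def vec_eq_iff)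
      then show ?thesis
        using eX by (simp add: g_sum Msym[of j] mult.commute) (simp add: M_def)
    qed
    have ut: "(\<Sum>i\<in>UNIV. x $ i *\<^sub>T e i q) \<in> tangent_space A q"
      using eX by (intro tangent.subspace_sum[OF tangent_subspace] tangent.subspace_scale[OF tangent_subspace]) auto
    have z: "(\<Sum>i\<in>UNIV. x $ i *\<^sub>T e i q) = 0"
    proof (rule g_nondegenerate[OF ut])
      fix w assume "w \<in> tangent_space A q"
      then obtain b where b: "w = (\<Sum>i\<in>UNIV. b i *\<^sub>T e i q)" by (rule tangent_basis_expand[OF eb])
      then have "g q w (\<Sum>i\<in>UNIV. x $ i *\<^sub>T e i q) = 0"
        using eX ut orth by (simp add: g_sum g_sym[OF field_tangent[OF eX] ut])
      then show "g q (\<Sum>i\<in>UNIV. x $ i *\<^sub>T e i q) w = 0"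
        using g_sym[OF \<open>w \<in> tangent_space A q\<close> ut] by simp
    qed
    have inj: "inj (\<lambda>i. e i q)" and ind: "tangent.independent (range (\<lambda>i. e i q))"
      using eb by (auto simp: tangent_basis_def)
    have "x $ i = 0" for i
    proof -
      have "(\<Sum>v\<in>range (\<lambda>i. e i q). x $ (inv (\<lambda>i. e i q) v) *\<^sub>T v) = 0"
        using z by (simp add: sum.reindex[OF inj] inv_f_f[OF inj])
      then have "x $ (inv (\<lambda>i. e i q) (e i q)) = 0"
        using tangent.independentD[OF ind, of "range (\<lambda>i. e i q)" "\<lambda>v. x $ (inv (\<lambda>i. e i q) v)" "e i q"] by auto
      then show ?thesis using inv_f_f[OF inj, of i] by simp
    qed
    then show ?thesis by (simp add: vec_eq_iff)
  qed
  then have "\<exists>B. B ** M = mat 1" using matrix_left_invertible_ker by blast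
  then have "invertible M" using invertible_left_inverse by blast
  then have inv: "matrix_inv M ** M = mat 1" 
    unfolding invertible_def matrix_inv_def by (metis (mono_tags, lifting) someI_ex)
  define a where "a i u = (\<Sum>j\<in>UNIV. matrix_inv M $ i $ j * g q u (e j q))" for i and u :: "'a tangent"
  have a_sum: "a i (\<Sum>k\<in>UNIV. c k *\<^sub>T u k) = (\<Sum>k\<in>UNIV. c k * a i (u k))"
    if "\<And>k. u k \<in> tangent_space A q" for i c and u :: "'m \<Rightarrow> _"
    using eX that
    by (simp add: a_def g_sum sum_distrib_left mult_ac, subst sum.swap) (rule refl)
  have a_e: "a i (e k q) = (if i = k then 1 else 0)" for i k
  proof -
    have "a i (e k q) = (matrix_inv M ** M) $ i $ k"
      by (simp add: a_def matrix_matrix_mult_def Msym[of _ k]) (simp add: M_def)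
    then show ?thesis by (simp add: inv mat_def)
  qed
  have expand: "u = (\<Sum>i\<in>UNIV. a i u *\<^sub>T e i q)" if u: "u \<in> tangent_space A q" for u
  proof -
    obtain c where c: "u = (\<Sum>i\<in>UNIV. c i *\<^sub>T e i q)" by (rule tangent_basis_expand[OF eb u])
    have "a i u = c i" for i
      using eX by (simp add: c a_sum a_e if_distrib[of "\<lambda>x. _ * x"] cong: if_cong)
    then show ?thesis using c by simp
  qed
  have "s q * a i (T (e i) q) = (\<Sum>k\<in>UNIV. eval1 (\<theta> k) (e i) q * a i (T (E k) q))" for i
  proof -
    have "s q *\<^sub>T T (e i) q = (\<Sum>k\<in>UNIV. eval1 (\<theta> k) (e i) q *\<^sub>T T (E k) q)"
      using fun_cong[OF frame_expand_image[OF fr T eX[of i]], of q]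
      by (simp only: sum_scale_vfield_apply scale_vfield_def[of s])
    moreover have "a i (s q *\<^sub>T u) = s q * a i u" if "u \<in> tangent_space A q" for u
      using g_left[OF that that field_tangent[OF eX], of "s q" 0]
      by (simp add: a_def sum_distrib_left mult_ac)
    ultimately have "s q * a i (T (e i) q) = a i (\<Sum>k\<in>UNIV. eval1 (\<theta> k) (e i) q *\<^sub>T T (E k) q)"
      using TX[OF eX] by (metis field_tangent)
    then show ?thesis using TX[OF frD(1)] by (simp add: a_sum)
  qed
  then have "s q * (\<Sum>i\<in>UNIV. a i (T (e i) q)) =
      (\<Sum>i\<in>UNIV. \<Sum>k\<in>UNIV. a i (T (E k) q) * \<theta> k q (e i q))"
    by (simp add: sum_distrib_left eval1_def mult.commute)
  also have "\<dots> = (\<Sum>k\<in>UNIV. \<theta> k q (\<Sum>i\<in>UNIV. a i (T (E k) q) *\<^sub>T e i q))"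
    by (subst sum.swap) (simp add: frame_form_sum[OF fr])
  also have "\<dots> = (\<Sum>k\<in>UNIV. eval1 (\<theta> k) (T (E k)) q)"
    using TX[OF frD(1)] by (simp add: expand[symmetric] eval1_def)
  finally show ?thesis by (simp add: a_def M_def eval2_def)
qed

end

section \<open>Sasaki-like manifolds\<close>

lemma fun_eq_minus_self: "f = - f \<Longrightarrow> f = (0 :: 'b \<Rightarrow> real)"
  by (simp add: fun_eq_iff fun_apply)

lemma vfield_scale_2: "(2 * f) *\<^sub>V X = f *\<^sub>V X + f *\<^sub>V X"
  by (simp only: mult_2 vfield.scale_left_distrib)

locale sasaki_like_manifold =
  fixes A :: "('a::{t2_space, second_countable_topology}, 'm::finite) atlas"
    and \<phi> :: "'a endo_field" and \<xi> :: "'a vfield" and \<eta> :: "'a one_form"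
    and g :: "'a bilinear_field" and D :: "'a vfield \<Rightarrow> 'a vfield \<Rightarrow> 'a vfield"
    and n :: nat
  assumes B_metric: "almost_contact_B_metric n A \<phi> \<xi> \<eta> g"
    and levi_civita: "levi_civita_connection A g D"
    and sasaki: "sasaki_like A \<phi> \<xi> \<eta> g D"

sublocale sasaki_like_manifold \<subseteq> pseudo_riemannian_manifold A g "n + 1" n
  using B_metric by unfold_locales (auto simp: almost_contact_B_metric_def)

context sasaki_like_manifold
begin

abbreviation "\<Phi> \<equiv> endo_apply \<phi>"
abbreviation "eta \<equiv> eval1 \<eta>"
abbreviation "G1 X Y \<equiv> G X Y - eta X * eta Y"
abbreviation "G2 X Y \<equiv> G (\<Phi> X) Y"

lemma xi [simp, intro]: "\<xi> \<in> \<X>"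
  and Phi_field [simp, intro]: "X \<in> \<X> \<Longrightarrow> \<Phi> X \<in> \<X>"
  and eta_smooth [simp, intro]: "X \<in> \<X> \<Longrightarrow> eta X \<in> \<F>"
  and Phi_xi [simp]: "\<Phi> \<xi> = 0"
  and eta_xi [simp]: "eta \<xi> = 1"
  and eta_Phi [simp]: "X \<in> \<X> \<Longrightarrow> eta (\<Phi> X) = 0"
  and Phi_Phi [simp]: "X \<in> \<X> \<Longrightarrow> \<Phi> (\<Phi> X) = - X + eta X *\<^sub>V \<xi>"
  and G_Phi_Phi: "X \<in> \<X> \<Longrightarrow> Y \<in> \<X> \<Longrightarrow> G (\<Phi> X) (\<Phi> Y) = - G X Y + eta X * eta Y"
  using B_metric
  unfolding almost_contact_B_metric_def smooth_endo_field_def smooth_one_form_def by blast+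

lemma card_m: "CARD('m) = 2 * n + 1"
  using B_metric unfolding almost_contact_B_metric_def by blast

lemma Phi_combination:
  "u \<in> tangent_space A p \<Longrightarrow> w \<in> tangent_space A p \<Longrightarrow>
    \<phi> p (r *\<^sub>T u + t *\<^sub>T w) = r *\<^sub>T \<phi> p u + t *\<^sub>T \<phi> p w"
  using B_metric unfolding almost_contact_B_metric_def smooth_endo_field_def by blast

lemma eta_combination:
  "u \<in> tangent_space A p \<Longrightarrow> w \<in> tangent_space A p \<Longrightarrow>
    \<eta> p (r *\<^sub>T u + t *\<^sub>T w) = r * \<eta> p u + t * \<eta> p w"
  using B_metric unfolding almost_contact_B_metric_def smooth_one_form_def by blast

lemma Phi_add [simp]: "X \<in> \<X> \<Longrightarrow> Y \<in> \<X> \<Longrightarrow> \<Phi> (X + Y) = \<Phi> X + \<Phi> Y"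
  and Phi_scale [simp]: "f \<in> \<F> \<Longrightarrow> X \<in> \<X> \<Longrightarrow> \<Phi> (f *\<^sub>V X) = f *\<^sub>V \<Phi> X"
  using Phi_combination[of "X p" p "Y p" 1 1 for p] Phi_combination[of "X p" p "X p" "f p" 0 for p]
  by (simp_all add: endo_apply_def scale_vfield_def fun_eq_iff plus_fun_apply)

lemma eta_add [simp]: "X \<in> \<X> \<Longrightarrow> Y \<in> \<X> \<Longrightarrow> eta (X + Y) = eta X + eta Y"
  and eta_scale [simp]: "f \<in> \<F> \<Longrightarrow> X \<in> \<X> \<Longrightarrow> eta (f *\<^sub>V X) = f * eta X"
  using eta_combination[of "X p" p "Y p" 1 1 for p] eta_combination[of "X p" p "X p" "f p" 0 for p]
  by (simp_all add: eval1_def scale_vfield_def fun_eq_iff fun_apply)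

lemma Phi_uminus [simp]: "X \<in> \<X> \<Longrightarrow> \<Phi> (- X) = - \<Phi> X"
  and eta_uminus [simp]: "X \<in> \<X> \<Longrightarrow> eta (- X) = - eta X"
  using Phi_scale[of "- 1" X] eta_scale[of "- 1" X] by (simp_all add: vfield_scale_minus)

lemma Phi_diff [simp]: "X \<in> \<X> \<Longrightarrow> Y \<in> \<X> \<Longrightarrow> \<Phi> (X - Y) = \<Phi> X - \<Phi> Y"
  and eta_diff [simp]: "X \<in> \<X> \<Longrightarrow> Y \<in> \<X> \<Longrightarrow> eta (X - Y) = eta X - eta Y"
  using Phi_add[of X "- Y"] eta_add[of X "- Y"] by simp_all

lemma eta_0 [simp]: "eta 0 = 0"
  using eta_diff[of 0 0] by simp

lemma G_xi [simp]: "X \<in> \<X> \<Longrightarrow> G X \<xi> = eta X" "X \<in> \<X> \<Longrightarrow> G \<xi> X = eta X"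
  using G_Phi_Phi[of X \<xi>] by (simp_all add: G_0 G_commute[of \<xi>])

text \<open>
  From the compatibility of \<open>g\<close> and \<open>\<phi>\<close> at \<open>\<phi> x\<close>, \<open>y\<close>.
\<close>
lemma Phi_self_adjoint: "X \<in> \<X> \<Longrightarrow> Y \<in> \<X> \<Longrightarrow> G X (\<Phi> Y) = G (\<Phi> X) Y"
  using G_Phi_Phi[of "\<Phi> X" Y] by (simp add: G_linear)

lemma G2_commute: "X \<in> \<X> \<Longrightarrow> Y \<in> \<X> \<Longrightarrow> G2 X Y = G2 Y X"
  using G_commute[of "\<Phi> X" Y] by (simp add: Phi_self_adjoint)

lemma D_field [simp, intro]: "X \<in> \<X> \<Longrightarrow> Y \<in> \<X> \<Longrightarrow> D X Y \<in> \<X>"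
  and D_add: "X \<in> \<X> \<Longrightarrow> Y \<in> \<X> \<Longrightarrow> Z \<in> \<X> \<Longrightarrow> D (X + Y) Z = D X Z + D Y Z"
    "X \<in> \<X> \<Longrightarrow> Y \<in> \<X> \<Longrightarrow> Z \<in> \<X> \<Longrightarrow> D X (Y + Z) = D X Y + D X Z"
  and D_scale: "f \<in> \<F> \<Longrightarrow> X \<in> \<X> \<Longrightarrow> Y \<in> \<X> \<Longrightarrow> D (f *\<^sub>V X) Y = f *\<^sub>V D X Y"
    "f \<in> \<F> \<Longrightarrow> X \<in> \<X> \<Longrightarrow> Y \<in> \<X> \<Longrightarrow> D X (f *\<^sub>V Y) = deriv_along X f *\<^sub>V Y + f *\<^sub>V D X Y"
  and torsion_free: "X \<in> \<X> \<Longrightarrow> Y \<in> \<X> \<Longrightarrow> D X Y - D Y X = lie_bracket X Y"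
  and deriv_G: "X \<in> \<X> \<Longrightarrow> Y \<in> \<X> \<Longrightarrow> Z \<in> \<X> \<Longrightarrow>
    deriv_along X (G Y Z) = G (D X Y) Z + G Y (D X Z)"
  using levi_civita unfolding levi_civita_connection_def by blast+

lemma D_uminus:
  "X \<in> \<X> \<Longrightarrow> Y \<in> \<X> \<Longrightarrow> D (- X) Y = - D X Y"
  "X \<in> \<X> \<Longrightarrow> Y \<in> \<X> \<Longrightarrow> D X (- Y) = - D X Y"
  using D_scale(1)[of "- 1" X Y] D_scale(2)[of "- 1" X Y] by (simp_all add: vfield_scale_minus)

lemma D_diff:
  "X \<in> \<X> \<Longrightarrow> Y \<in> \<X> \<Longrightarrow> Z \<in> \<X> \<Longrightarrow> D (X - Y) Z = D X Z - D Y Z"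
  "X \<in> \<X> \<Longrightarrow> Y \<in> \<X> \<Longrightarrow> Z \<in> \<X> \<Longrightarrow> D X (Y - Z) = D X Y - D X Z"
  using D_add(1)[of X "- Y" Z] D_add(2)[of X Y "- Z"] by (simp_all add: D_uminus)

lemmas D_linear = D_add D_scale D_uminus D_diff

lemma D_Phi:
  assumes "X \<in> \<X>" "Y \<in> \<X>"
  shows "D X (\<Phi> Y) = \<Phi> (D X Y) - G X Y *\<^sub>V \<xi> - eta Y *\<^sub>V X + (2 * eta X * eta Y) *\<^sub>V \<xi>"
proof -
  have "(\<lambda>p. 2 * \<eta> p (X p) * \<eta> p (Y p)) = 2 * eta X * eta Y"
    by (simp add: fun_eq_iff eval1_def fun_apply)
  then show ?thesis
    using sasaki assms unfolding sasaki_like_def cov_deriv_endo_def by (simp add: algebra_simps)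
qed

text \<open>The structure equation at \<open>y = \<xi>\<close>, composed with \<open>\<phi>\<close>.\<close>
lemma D_xi [simp]:
  assumes X: "X \<in> \<X>" shows "D X \<xi> = - \<Phi> X"
proof -
  have "G (D X \<xi>) \<xi> + G \<xi> (D X \<xi>) = 0"
    using deriv_G[of X \<xi> \<xi>] X by simp
  then have "eta (D X \<xi>) = - eta (D X \<xi>)" using X by (simp add: eq_neg_iff_add_eq_0)
  then have eta0: "eta (D X \<xi>) = 0" by (rule fun_eq_minus_self)
  have D0: "D X 0 = 0" using D_diff(2)[of X 0 0] X by simp
  have "\<Phi> (D X \<xi>) = eta X *\<^sub>V \<xi> + X - (2 * eta X) *\<^sub>V \<xi>"
    using D_Phi[OF X xi] X by (simp add: D0 algebra_simps eq_neg_iff_add_eq_0)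
  also have "\<dots> = X - eta X *\<^sub>V \<xi>"
    by (simp add: vfield_scale_2 mult.assoc)
  finally have "\<Phi> (\<Phi> (D X \<xi>)) = \<Phi> (X - eta X *\<^sub>V \<xi>)" by simp
  then have "- D X \<xi> = \<Phi> X" using X eta0 by simp
  then show ?thesis by (metis minus_minus)
qed

lemma deriv_eta:
  "X \<in> \<X> \<Longrightarrow> Y \<in> \<X> \<Longrightarrow> deriv_along X (eta Y) = eta (D X Y) - G2 X Y"
  using deriv_G[of X Y \<xi>] by (simp add: G_uminus G2_commute Phi_self_adjoint)

lemma bracket_eq: "X \<in> \<X> \<Longrightarrow> Y \<in> \<X> \<Longrightarrow> lie_bracket X Y = D X Y - D Y X"
  by (simp add: torsion_free)

lemma D_xi_eq: "X \<in> \<X> \<Longrightarrow> D \<xi> X = lie_bracket \<xi> X - \<Phi> X"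
  by (simp add: bracket_eq)

lemma eta_bracket_xi: "X \<in> \<X> \<Longrightarrow> eta (lie_bracket \<xi> X) = deriv_along \<xi> (eta X)"
  by (simp add: bracket_eq deriv_eta G_0)

lemma Phi_bracket_xi: "X \<in> \<X> \<Longrightarrow> lie_bracket \<xi> (\<Phi> X) = \<Phi> (lie_bracket \<xi> X)"
  by (simp add: bracket_eq D_Phi vfield_scale_2 mult.assoc)

lemma deriv_xi_G:
  assumes "X \<in> \<X>" "Y \<in> \<X>"
  shows "deriv_along \<xi> (G X Y) = G (lie_bracket \<xi> X) Y + G X (lie_bracket \<xi> Y) - 2 * G2 X Y"
  using assms by (simp add: deriv_G D_xi_eq G_linear Phi_self_adjoint algebra_simps)

text \<open>
  The Lie derivative of the connection along \<open>\<xi>\<close>. The difference of the two sides, as a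
  trilinear form, is symmetric in its first two arguments, because both connections are torsion
  free, and skew in the last two, by the Lie derivative of \<open>\<nabla>g = 0\<close>; so it vanishes.
\<close>
lemma lie_xi_connection:
  assumes "X \<in> \<X>" "Y \<in> \<X>"
  shows "lie_bracket \<xi> (D X Y) = D (lie_bracket \<xi> X) Y + D X (lie_bracket \<xi> Y) + (2 * G1 X Y) *\<^sub>V \<xi>"
proof -
  let ?b = "lie_bracket \<xi>"
  define C where "C X Y = ?b (D X Y) - D (?b X) Y - D X (?b Y)" for X Y
  have CX [simp]: "C X Y \<in> \<X>" if "X \<in> \<X>" "Y \<in> \<X>" for X Y
    using that by (simp add: C_def)
  have sym: "C X Y = C Y X" if "X \<in> \<X>" "Y \<in> \<X>" for X Y
  proof -
    have "C X Y - C Y X = ?b (D X Y - D Y X) - (D (?b X) Y - D Y (?b X)) - (D X (?b Y) - D (?b Y) X)"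
      using that by (simp add: C_def bracket_diff)
    also have "\<dots> = ?b (lie_bracket X Y) - lie_bracket (?b X) Y - lie_bracket X (?b Y)"
      using that by (simp add: torsion_free)
    also have "\<dots> = 0" using that by (simp add: jacobi[of \<xi> X Y])
    finally show ?thesis by simp
  qed
  have metric: "G (C X Y) Z + G (C X Z) Y = 2 * (G1 X Y * eta Z + eta Y * G1 X Z)"
    if X: "X \<in> \<X>" and Y: "Y \<in> \<X>" and Z: "Z \<in> \<X>" for X Y Z
  proof -
    have e1: "deriv_along \<xi> (deriv_along X (G Y Z)) - deriv_along X (deriv_along \<xi> (G Y Z)) =
        deriv_along (?b X) (G Y Z)" by simp
    have e2: "deriv_along \<xi> (deriv_along X (G Y Z)) =
        G (?b (D X Y)) Z + G (D X Y) (?b Z) - 2 * G2 (D X Y) Z +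
        (G (?b Y) (D X Z) + G Y (?b (D X Z)) - 2 * G2 Y (D X Z))"
      using that by (simp add: deriv_G[of X] deriv_xi_G)
    have e3: "deriv_along X (deriv_along \<xi> (G Y Z)) =
        G (D X (?b Y)) Z + G (?b Y) (D X Z) + (G (D X Y) (?b Z) + G Y (D X (?b Z)))
        - 2 * (G (D X (\<Phi> Y)) Z + G2 Y (D X Z))"
      using that by (simp add: deriv_G[of X] deriv_xi_G)
    have e4: "deriv_along (?b X) (G Y Z) = G (D (?b X) Y) Z + G Y (D (?b X) Z)"
      using that by (simp add: deriv_G del: deriv_vfield)
    have e5: "G (D X (\<Phi> Y)) Z = G2 (D X Y) Z - G X Y * eta Z - eta Y * G X Z + 2 * eta X * eta Y * eta Z"
      using that by (simp add: D_Phi G_linear)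
    have "G (C X Y) Z + G Y (C X Z) = 2 * (G1 X Y * eta Z + eta Y * G1 X Z)"
    proof
      fix p
      have e6: "G (C X Y) Z + G Y (C X Z) =
          G (?b (D X Y)) Z - G (D (?b X) Y) Z - G (D X (?b Y)) Z +
          (G Y (?b (D X Z)) - G Y (D (?b X) Z) - G Y (D X (?b Z)))"
        using that by (simp add: C_def G_linear)
      show "(G (C X Y) Z + G Y (C X Z)) p = (2 * (G1 X Y * eta Z + eta Y * G1 X Z)) p"
        using fun_cong[OF e1[unfolded e2 e3 e4 e5], of p] fun_cong[OF e6, of p]
        by (simp add: fun_apply algebra_simps)
    qed
    then show ?thesis using that by (simp add: G_commute[of Y])
  qed
  define t where "t X Y Z = G (C X Y) Z - 2 * G1 X Y * eta Z" for X Y Z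
  have t1: "t X Y Z = t Y X Z" if "X \<in> \<X>" "Y \<in> \<X>" for X Y Z
    using that by (simp add: t_def sym[of X] G_commute[of X] mult.commute)
  have t2: "t X Y Z = - t X Z Y" if "X \<in> \<X>" "Y \<in> \<X>" "Z \<in> \<X>" for X Y Z
    using metric[OF that] by (simp add: t_def algebra_simps eq_neg_iff_add_eq_0)
  have "t X Y Z = 0" if Z: "Z \<in> \<X>" for Z
  proof (rule fun_eq_minus_self)
    have "t X Y Z = - t X Z Y" "t X Z Y = t Z X Y" "t Z X Y = - t Z Y X" "t Z Y X = t Y Z X"
      "t Y Z X = - t Y X Z" "t Y X Z = t X Y Z"
      using assms Z t1 t2 by blast+
    then show "t X Y Z = - t X Y Z" by simp
  qed
  then have "C X Y - (2 * G1 X Y) *\<^sub>V \<xi> = 0"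
    using assms by (intro G_nondegenerate) (simp_all add: t_def G_linear)
  then show ?thesis by (simp add: C_def algebra_simps)
qed

text \<open>
  The left-hand side is \<open>(\<nabla>\<^sub>x G1)(y, z) - (\<nabla>\<^sub>y G1)(x, z)\<close>; it is the coefficient of \<open>\<xi>\<close> in \<open>L\<^sub>\<xi> R\<close>, up to a factor 2.
\<close>
lemma G1_codazzi:
  assumes "X \<in> \<X>" "Y \<in> \<X>" "Z \<in> \<X>"
  shows "deriv_along X (G1 Y Z) + G1 X (D Y Z) - deriv_along Y (G1 X Z) - G1 Y (D X Z) - G1 (lie_bracket X Y) Z =
    eta Y * G2 X Z - eta X * G2 Y Z"
proof -
  have "G2 Y X = G2 X Y" "G (D Y X) Z = G Z (D Y X)" "G Y (D X Z) = G (D X Z) Y" "G X (D Y Z) = G (D Y Z) X"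
    using assms by (blast intro: G2_commute G_commute D_field)+
  then show ?thesis
    using assms by (simp add: deriv_G deriv_eta bracket_eq G_linear algebra_simps)
qed

text \<open>
  The Lie derivative commutes with the formation of the curvature up to derivatives of
  \<open>L\<^sub>\<xi> \<nabla> = 2 G1 \<otimes> \<xi>\<close>, and \<open>\<nabla>\<xi> = - \<phi>\<close>.
\<close>
lemma lie_xi_curvature:
  assumes "X \<in> \<X>" "Y \<in> \<X>" "Z \<in> \<X>"
  shows "lie_bracket \<xi> (curvature D X Y Z) =
    curvature D (lie_bracket \<xi> X) Y Z + curvature D X (lie_bracket \<xi> Y) Z + curvature D X Y (lie_bracket \<xi> Z)
    + (2 * (eta Y * G2 X Z - eta X * G2 Y Z)) *\<^sub>V \<xi> - (2 * G1 Y Z) *\<^sub>V \<Phi> X + (2 * G1 X Z) *\<^sub>V \<Phi> Y"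
proof -
  let ?b = "lie_bracket \<xi>"
  have DD: "?b (D X (D Y Z)) = D (?b X) (D Y Z) + D X (D (?b Y) Z) + D X (D Y (?b Z)) +
      (2 * (deriv_along X (G1 Y Z) + G1 X (D Y Z))) *\<^sub>V \<xi> - (2 * G1 Y Z) *\<^sub>V \<Phi> X"
    if "X \<in> \<X>" "Y \<in> \<X>" "Z \<in> \<X>" for X Y Z
  proof -
    define h where "h = 2 * G1 Y Z"
    have h: "h \<in> \<F>" using that by (simp add: h_def)
    have s1: "?b (D X (D Y Z)) = D (?b X) (D Y Z) + D X (D (?b Y) Z + D Y (?b Z) + h *\<^sub>V \<xi>) + (2 * G1 X (D Y Z)) *\<^sub>V \<xi>"
      using that by (simp only: lie_xi_connection D_field h_def)
    have s2: "D X (D (?b Y) Z + D Y (?b Z) + h *\<^sub>V \<xi>) = D X (D (?b Y) Z) + D X (D Y (?b Z)) +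
        (deriv_along X h *\<^sub>V \<xi> - h *\<^sub>V \<Phi> X)"
      using that h by (simp add: D_add D_scale)
    have s3: "deriv_along X h = 2 * deriv_along X (G1 Y Z)"
      using that by (simp add: h_def)
    show ?thesis unfolding s1 s2 s3
      by (simp add: h_def vfield.scale_left_distrib distrib_left
          del: deriv_add deriv_diff deriv_mult)
  qed
  have "?b (curvature D X Y Z) =
    curvature D (?b X) Y Z + curvature D X (?b Y) Z + curvature D X Y (?b Z)
    + (2 * (deriv_along X (G1 Y Z) + G1 X (D Y Z) - deriv_along Y (G1 X Z) - G1 Y (D X Z) - G1 (lie_bracket X Y) Z)) *\<^sub>V \<xi>
    - (2 * G1 Y Z) *\<^sub>V \<Phi> X + (2 * G1 X Z) *\<^sub>V \<Phi> Y"
  proof -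
    define a b c where "a = deriv_along X (G1 Y Z) + G1 X (D Y Z)"
      "b = deriv_along Y (G1 X Z) + G1 Y (D X Z)" "c = G1 (lie_bracket X Y) Z"
    have s1: "?b (curvature D X Y Z) = ?b (D X (D Y Z)) - ?b (D Y (D X Z)) - ?b (D (lie_bracket X Y) Z)"
      using assms by (simp add: curvature_def bracket_diff)
    have s2: "?b (D (lie_bracket X Y) Z) =
        D (lie_bracket (?b X) Y) Z + D (lie_bracket X (?b Y)) Z + D (lie_bracket X Y) (?b Z) + (2 * c) *\<^sub>V \<xi>"
      using assms by (simp only: lie_xi_connection bracket_field jacobi[of \<xi> X Y] D_add xi a_b_c_def)
    have s3: "?b (D X (D Y Z)) - ?b (D Y (D X Z)) - (D (lie_bracket (?b X) Y) Z + D (lie_bracket X (?b Y)) Z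
          + D (lie_bracket X Y) (?b Z) + (2 * c) *\<^sub>V \<xi>) =
        curvature D (?b X) Y Z + curvature D X (?b Y) Z + curvature D X Y (?b Z)
        + (2 * (a - b - c)) *\<^sub>V \<xi> - (2 * G1 Y Z) *\<^sub>V \<Phi> X + (2 * G1 X Z) *\<^sub>V \<Phi> Y"
      unfolding DD[OF assms] DD[OF assms(2,1,3)] curvature_def a_b_c_def[symmetric]
      by (simp add: vfield.scale_left_diff_distrib right_diff_distrib)
    show ?thesis unfolding s1 s2 s3 unfolding a_b_c_def by (simp only: diff_diff_eq add_ac)
  qed
  then show ?thesis unfolding G1_codazzi[OF assms] .
qed

end

section \<open>The Ricci tensor along the Reeb field\<close>

context sasaki_like_manifold
begin

lemma curvature_field_linear:
  assumes "Y \<in> \<X>" "Z \<in> \<X>"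
  shows "field_linear (\<lambda>X. curvature D X Y Z)"
  unfolding field_linear_def
proof (intro conjI ballI)
  fix X assume X: "X \<in> \<X>"
  show "curvature D X Y Z \<in> \<X>" using X assms by (simp add: curvature_def)
  show "curvature D (X + W) Y Z = curvature D X Y Z + curvature D W Y Z" if "W \<in> \<X>" for W
    using X that assms by (simp add: curvature_def D_linear bracket_add)
next
  fix f X assume "f \<in> \<F>" "X \<in> \<X>"
  then show "curvature D (f *\<^sub>V X) Y Z = f *\<^sub>V curvature D X Y Z"
    using assms
    by (simp add: curvature_def D_linear bracket_scale vfield.scale_right_diff_distrib)
qed

text \<open>
  The chosen frames in the definition of \<open>\<rho>\<close> vary from point to point; the right-hand side does not mention them
  and can be differentiated.
\<close>
lemma ricci_eq_frame_trace:
  assumes fr: "cut_off_frame E \<theta> s" and "Y \<in> \<X>" "Z \<in> \<X>"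
  shows "s * ricci A g D Y Z = (\<Sum>i\<in>UNIV. eval1 (\<theta> i) (curvature D (E i) Y Z))"
proof
  fix p
  have e: "frame_at A p (SOME e. frame_at A p e)" using frame_at_exists by (rule someI_ex)
  show "(s * ricci A g D Y Z) p = (\<Sum>i\<in>UNIV. eval1 (\<theta> i) (curvature D (E i) Y Z)) p"
    using metric_trace_eq_frame_trace[OF fr curvature_field_linear[OF assms(2,3)] e]
    by (simp add: ricci_def ricci_sum_def curvature4_def fun_apply sum_fun_apply)
qed

lemma curvature_xi:
  assumes "X \<in> \<X>" "Y \<in> \<X>"
  shows "curvature D X Y \<xi> = eta Y *\<^sub>V X - eta X *\<^sub>V Y"
proof -
  have "G Y X = G X Y" using assms by (rule G_commute[OF _ _, rotated])
  then show ?thesis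
    using assms by (simp add: curvature_def D_uminus D_Phi bracket_eq[of X Y] mult_ac)
qed

text \<open>
  The trace of \<open>x \<mapsto> \<eta> (y) x - \<eta> (x) y\<close> is \<open>(2n + 1) \<eta> (y) - \<eta> (y)\<close>.
\<close>
lemma ricci_xi:
  assumes Y: "Y \<in> \<X>"
  shows "ricci A g D Y \<xi> = (\<lambda>_. 2 * real n) * eta Y"
proof
  fix p
  obtain E \<theta> s where fr: "cut_off_frame E \<theta> s" and s: "s p \<noteq> 0" by (rule cut_off_frame_exists)
  note frD = cut_off_frameD[OF fr]
  have eta: "form_linear eta" by (simp add: form_linear_def)
  have "eval1 (\<theta> i) (curvature D (E i) Y \<xi>) = eta Y * s - eval1 (\<theta> i) Y * eta (E i)" for i
  proof -
    have "eval1 (\<theta> i) (eta Y *\<^sub>V E i + (- eta (E i)) *\<^sub>V Y) = eta Y * s + (- eta (E i)) * eval1 (\<theta> i) Y"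
      using Y frD(1) form_linearD[OF frame_form_linear[OF fr]] by (simp only: field_scale eta_smooth smooth_uminus frD(6) if_True simp_thms)
    then show ?thesis
      using Y frD(1) by (simp add: curvature_xi vfield_scale_minus mult.commute)
  qed
  then have "s * ricci A g D Y \<xi> = of_nat CARD('m) * (eta Y * s) - s * eta Y"
    using ricci_eq_frame_trace[OF fr Y xi] frame_contraction[OF fr eta Y]
    by (simp add: sum_subtractf)
  from fun_cong[OF this, of p] have "s p * ricci A g D Y \<xi> p = s p * (2 * real n * eta Y p)"
    by (simp add: fun_apply card_m algebra_simps)
  then show "ricci A g D Y \<xi> p = ((\<lambda>_. 2 * real n) * eta Y) p"
    using s by (simp add: fun_apply)
qed

text \<open>
  Contracting the Lie derivative of the curvature tensor leaves a multiple of the trace of \<open>\<phi>\<close>,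
  which is \<open>0\<close> as \<open>\<phi>^3 = - \<phi>\<close>. The smoothness of \<open>\<rho>\<close> is assumed, as a derivation is \<open>0\<close> on other
  functions; on a soliton it follows from the soliton equation.
\<close>
lemma lie_xi_ricci:
  assumes smooth: "\<And>Y Z. Y \<in> \<X> \<Longrightarrow> Z \<in> \<X> \<Longrightarrow> ricci A g D Y Z \<in> \<F>"
    and Y: "Y \<in> \<X>" and Z: "Z \<in> \<X>"
  shows "deriv_along \<xi> (ricci A g D Y Z) =
    ricci A g D (lie_bracket \<xi> Y) Z + ricci A g D Y (lie_bracket \<xi> Z)"
proof
  fix p
  let ?b = "lie_bracket \<xi>" and ?d = "deriv_along \<xi>" and ?r = "ricci A g D"
  obtain E \<theta> s where fr: "cut_off_frame E \<theta> s" and s: "s p \<noteq> 0" by (rule cut_off_frame_exists)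
  note frD = cut_off_frameD[OF fr]
  note th = form_linearD[OF frame_form_linear[OF fr]]
  note [simp] = frD(1,2,4)
  define T where "T X = curvature D X Y Z" for X
  have Tl: "field_linear T" unfolding T_def by (rule curvature_field_linear[OF Y Z])
  have TX [simp]: "T X \<in> \<X>" if "X \<in> \<X>" for X by (rule field_linearD(1)[OF Tl that])
  \<comment> \<open>\<open>L i\<close> is the Lie derivative of the \<open>i\<close>-th form of the coframe.\<close>
  define L where "L i X = ?d (eval1 (\<theta> i) X) - eval1 (\<theta> i) (?b X)" for i X
  have Ll: "form_linear (L i)" for i
    by (simp add: form_linear_def L_def th bracket_add bracket_scale algebra_simps)
  define Q where "Q X = (2 * (eta Y * G2 X Z - eta X * G2 Y Z)) *\<^sub>V \<xi> +
    (- (2 * G1 Y Z)) *\<^sub>V \<Phi> X + (2 * G1 X Z) *\<^sub>V \<Phi> Y" for X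
  have QX [simp]: "Q X \<in> \<X>" if "X \<in> \<X>" for X
    using that Y Z by (simp add: Q_def)
  have bT: "?b (T X) = T (?b X) + curvature D X (?b Y) Z + curvature D X Y (?b Z) + Q X" if "X \<in> \<X>" for X
    unfolding T_def Q_def lie_xi_curvature[OF that Y Z]
    by (simp add: vfield_scale_minus algebra_simps)
  have trQ: "(\<Sum>i\<in>UNIV. eval1 (\<theta> i) (Q (E i))) = 0"
  proof -
    have fl: "form_linear (\<lambda>X. G2 X Z)" "form_linear eta" "form_linear (\<lambda>X. G1 X Z)"
      using Z by (simp_all add: form_linear_def G_linear algebra_simps)
    have Phil: "field_linear \<Phi>" by (simp add: field_linear_def)
    have tr\<Phi>: "(\<Sum>i\<in>UNIV. eval1 (\<theta> i) (\<Phi> (E i))) = 0"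
      by (rule frame_trace_cube_eq_minus[OF fr Phil]) simp
    have "eval1 (\<theta> i) (Q (E i)) = 2 * eta Y * (eval1 (\<theta> i) \<xi> * G2 (E i) Z)
        - 2 * G2 Y Z * (eval1 (\<theta> i) \<xi> * eta (E i))
        - 2 * G1 Y Z * eval1 (\<theta> i) (\<Phi> (E i)) + 2 * (eval1 (\<theta> i) (\<Phi> Y) * G1 (E i) Z)" for i
    proof -
      have "eval1 (\<theta> i) (a *\<^sub>V \<xi> + b *\<^sub>V \<Phi> (E i) + c *\<^sub>V \<Phi> Y) =
          a * eval1 (\<theta> i) \<xi> + b * eval1 (\<theta> i) (\<Phi> (E i)) + c * eval1 (\<theta> i) (\<Phi> Y)"
        if "a \<in> \<F>" "b \<in> \<F>" "c \<in> \<F>" for a b c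
        using that Y by (simp add: th)
      then have "eval1 (\<theta> i) (Q (E i)) = (2 * (eta Y * G2 (E i) Z - eta (E i) * G2 Y Z)) * eval1 (\<theta> i) \<xi> +
          (- (2 * G1 Y Z)) * eval1 (\<theta> i) (\<Phi> (E i)) + (2 * G1 (E i) Z) * eval1 (\<theta> i) (\<Phi> Y)"
        unfolding Q_def using Y Z by simp
      then show ?thesis by (simp add: algebra_simps)
    qed
    then have "(\<Sum>i\<in>UNIV. eval1 (\<theta> i) (Q (E i))) = 2 * eta Y * (s * G2 \<xi> Z)
        - 2 * G2 Y Z * (s * eta \<xi>) - 2 * G1 Y Z * 0 + 2 * (s * G1 (\<Phi> Y) Z)"
      using frame_contraction[OF fr fl(1) xi] frame_contraction[OF fr fl(2) xi]
        frame_contraction[OF fr fl(3) Phi_field[OF Y]] tr\<Phi>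
      by (simp only: sum.distrib sum_subtractf sum_distrib_left[symmetric])
    then show ?thesis using Y Z by (simp add: G_0 algebra_simps)
  qed
  have tr: "s * ?r Y' Z' = (\<Sum>i\<in>UNIV. eval1 (\<theta> i) (curvature D (E i) Y' Z'))"
    if "Y' \<in> \<X>" "Z' \<in> \<X>" for Y' Z'
    by (rule ricci_eq_frame_trace[OF fr that])
  have trT: "s * ?r Y Z = (\<Sum>i\<in>UNIV. eval1 (\<theta> i) (T (E i)))"
    using tr[OF Y Z] by (simp add: T_def)
  have CX: "curvature D X Y' Z' \<in> \<X>" if "X \<in> \<X>" "Y' \<in> \<X>" "Z' \<in> \<X>" for X Y' Z'
    using field_linearD(1)[OF curvature_field_linear] that by simp
  have main: "?d s * ?r Y Z + s * ?d (?r Y Z) =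
      (\<Sum>i\<in>UNIV. L i (T (E i)) + eval1 (\<theta> i) (T (?b (E i)))) + s * ?r (?b Y) Z + s * ?r Y (?b Z)"
  proof -
    have "?d s * ?r Y Z + s * ?d (?r Y Z) = ?d (s * ?r Y Z)"
      using smooth[OF Y Z] by simp
    also have "\<dots> = (\<Sum>i\<in>UNIV. ?d (eval1 (\<theta> i) (T (E i))))"
      unfolding trT by simp
    also have "\<dots> = (\<Sum>i\<in>UNIV. L i (T (E i)) + eval1 (\<theta> i) (T (?b (E i)))
        + eval1 (\<theta> i) (curvature D (E i) (?b Y) Z) + eval1 (\<theta> i) (curvature D (E i) Y (?b Z))
        + eval1 (\<theta> i) (Q (E i)))"
    proof (rule sum.cong)
      fix i
      have "eval1 (\<theta> i) (?b (T (E i))) = eval1 (\<theta> i) (T (?b (E i)))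
        + eval1 (\<theta> i) (curvature D (E i) (?b Y) Z) + eval1 (\<theta> i) (curvature D (E i) Y (?b Z))
        + eval1 (\<theta> i) (Q (E i))"
        using Y Z by (simp add: bT th CX)
      then show "?d (eval1 (\<theta> i) (T (E i))) = L i (T (E i)) + eval1 (\<theta> i) (T (?b (E i)))
        + eval1 (\<theta> i) (curvature D (E i) (?b Y) Z) + eval1 (\<theta> i) (curvature D (E i) Y (?b Z))
        + eval1 (\<theta> i) (Q (E i))"
        by (simp add: L_def add.assoc)
    qed simp
    finally show ?thesis
      using Y Z by (simp add: sum.distrib trQ tr)
  qed
  \<comment> \<open>The Lie derivative of the frame and of the coframe contribute only the derivative of the cut-off factor;
     this is the Lie derivative of the expansion \<open>s X = \<Sum> \<theta>\<^sub>k (X) E\<^sub>k\<close>, with \<open>T\<close> applied and contracted.\<close>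
  have corr: "s * (?d s * ?r Y Z) = s * (\<Sum>i\<in>UNIV. L i (T (E i)) + eval1 (\<theta> i) (T (?b (E i))))"
  proof -
    have lieE: "?d s *\<^sub>V X = (\<Sum>k\<in>UNIV. L k X *\<^sub>V E k) + (\<Sum>k\<in>UNIV. eval1 (\<theta> k) X *\<^sub>V ?b (E k))"
      if X: "X \<in> \<X>" for X
    proof -
      have "?d s *\<^sub>V X + s *\<^sub>V ?b X = ?b (s *\<^sub>V X)" using X by (simp add: bracket_scale)
      also have "\<dots> = (\<Sum>k\<in>UNIV. ?d (eval1 (\<theta> k) X) *\<^sub>V E k + eval1 (\<theta> k) X *\<^sub>V ?b (E k))"
        unfolding frD(5)[OF X] using X by (simp add: bracket_sum bracket_scale)
      also have "s *\<^sub>V ?b X = (\<Sum>k\<in>UNIV. eval1 (\<theta> k) (?b X) *\<^sub>V E k)"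
        using X by (intro frD(5)) simp
      finally show ?thesis
        by (simp add: L_def vfield.scale_left_diff_distrib sum_subtractf sum.distrib algebra_simps)
    qed
    have Lsm: "L k X \<in> \<F>" if "X \<in> \<X>" for k X using that by (simp add: L_def)
    have *: "?d s * eval1 (\<theta> j) (T (E j)) = (\<Sum>k\<in>UNIV. L k (E j) * eval1 (\<theta> j) (T (E k)))
        + (\<Sum>k\<in>UNIV. eval1 (\<theta> k) (E j) * eval1 (\<theta> j) (T (?b (E k))))" for j
    proof -
      have "?d s * eval1 (\<theta> j) (T (E j)) = eval1 (\<theta> j) (T (?d s *\<^sub>V E j))"
        by (simp add: field_linearD[OF Tl] th)
      also have "T (?d s *\<^sub>V E j) = (\<Sum>k\<in>UNIV. L k (E j) *\<^sub>V T (E k)) + (\<Sum>k\<in>UNIV. eval1 (\<theta> k) (E j) *\<^sub>V T (?b (E k)))"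
        unfolding lieE[OF frD(1)]
        by (simp add: field_linearD(2)[OF Tl] field_linear_sum[OF Tl] Lsm)
      also have "eval1 (\<theta> j) \<dots> = (\<Sum>k\<in>UNIV. L k (E j) * eval1 (\<theta> j) (T (E k)))
        + (\<Sum>k\<in>UNIV. eval1 (\<theta> k) (E j) * eval1 (\<theta> j) (T (?b (E k))))"
        by (simp add: th form_linear_sum[OF frame_form_linear[OF fr]] Lsm)
      finally show ?thesis .
    qed
    have "s * (?d s * ?r Y Z) = (\<Sum>j\<in>UNIV. ?d s * eval1 (\<theta> j) (T (E j)))"
      by (simp add: sum_distrib_left[symmetric] trT[symmetric] mult.left_commute)
    also have "\<dots> = (\<Sum>k\<in>UNIV. \<Sum>j\<in>UNIV. eval1 (\<theta> j) (T (E k)) * L k (E j))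
        + (\<Sum>j\<in>UNIV. \<Sum>k\<in>UNIV. eval1 (\<theta> k) (E j) * eval1 (\<theta> j) (T (?b (E k))))"
      unfolding * sum.distrib
      by (subst (1) sum.swap) (simp add: mult.commute)
    also have "\<dots> = (\<Sum>k\<in>UNIV. s * L k (T (E k))) + (\<Sum>j\<in>UNIV. s * eval1 (\<theta> j) (T (?b (E j))))"
      by (simp add: frame_contraction[OF fr Ll] frD(6) if_distrib[of "\<lambda>x. x * _"] cong: if_cong)
    finally show ?thesis by (simp add: sum.distrib sum_distrib_left distrib_left)
  qed
  have "s * (s * ?d (?r Y Z)) = s * (s * ?r (?b Y) Z + s * ?r Y (?b Z))"
  proof -
    define c where "c = (\<Sum>i\<in>UNIV. L i (T (E i)) + eval1 (\<theta> i) (T (?b (E i))))"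
    have "s * (?d s * ?r Y Z) + s * (s * ?d (?r Y Z)) = s * c + s * (s * ?r (?b Y) Z + s * ?r Y (?b Z))"
      using arg_cong[OF main, of "\<lambda>x. s * x"] by (simp add: c_def[symmetric] distrib_left add.assoc)
    moreover have "s * (?d s * ?r Y Z) = s * c" using corr by (simp add: c_def)
    ultimately show ?thesis by simp
  qed
  from fun_cong[OF this, of p] show "?d (?r Y Z) p = (?r (?b Y) Z + ?r Y (?b Z)) p"
    using s by (simp add: fun_apply distrib_left[symmetric])
qed

end

section \<open>Lie derivatives and the Tachibana operator\<close>

context smooth_manifold
begin

definition lie :: "'a vfield \<Rightarrow> ('a vfield \<Rightarrow> 'a vfield \<Rightarrow> 'a \<Rightarrow> real) \<Rightarrow> 'a vfield \<Rightarrow> 'a vfield \<Rightarrow> 'a \<Rightarrow> real" where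
  "lie X B Y Z = deriv_along X (B Y Z) - B (lie_bracket X Y) Z - B Y (lie_bracket X Z)"

definition smooth_biadditive :: "('a vfield \<Rightarrow> 'a vfield \<Rightarrow> 'a \<Rightarrow> real) \<Rightarrow> bool" where
  "smooth_biadditive B \<longleftrightarrow> (\<forall>Y\<in>\<X>. \<forall>Z\<in>\<X>. B Y Z \<in> \<F>) \<and>
     (\<forall>X\<in>\<X>. \<forall>Y\<in>\<X>. \<forall>Z\<in>\<X>. B (X + Y) Z = B X Z + B Y Z \<and> B Z (X + Y) = B Z X + B Z Y)"

lemma smooth_biadditiveD:
  assumes "smooth_biadditive B"
  shows "Y \<in> \<X> \<Longrightarrow> Z \<in> \<X> \<Longrightarrow> B Y Z \<in> \<F>"
    "X \<in> \<X> \<Longrightarrow> Y \<in> \<X> \<Longrightarrow> Z \<in> \<X> \<Longrightarrow> B (X + Y) Z = B X Z + B Y Z"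
    "X \<in> \<X> \<Longrightarrow> Y \<in> \<X> \<Longrightarrow> Z \<in> \<X> \<Longrightarrow> B Z (X + Y) = B Z X + B Z Y"
  using assms unfolding smooth_biadditive_def by blast+

lemma lie_cong:
  "X \<in> \<X> \<Longrightarrow> Y \<in> \<X> \<Longrightarrow> Z \<in> \<X> \<Longrightarrow> (\<And>Y Z. Y \<in> \<X> \<Longrightarrow> Z \<in> \<X> \<Longrightarrow> B Y Z = B' Y Z) \<Longrightarrow>
    lie X B Y Z = lie X B' Y Z"
  by (simp add: lie_def)

text \<open>
  The Jacobi identity for the bracket, carried over to the action of fields on forms; additivity of the form takes
  it through the arguments.
\<close>
lemma lie_commute:
  assumes B: "smooth_biadditive B" and X: "X \<in> \<X>" and Y: "Y \<in> \<X>" and Z: "Z \<in> \<X>" and W: "W \<in> \<X>"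
  shows "lie X (lie Y B) Z W = lie Y (lie X B) Z W + lie (lie_bracket X Y) B Z W"
proof -
  note B = smooth_biadditiveD[OF B]
  have j: "B (lie_bracket X (lie_bracket Y Z)) W = B (lie_bracket (lie_bracket X Y) Z) W + B (lie_bracket Y (lie_bracket X Z)) W"
    "B Z (lie_bracket X (lie_bracket Y W)) = B Z (lie_bracket (lie_bracket X Y) W) + B Z (lie_bracket Y (lie_bracket X W))"
    using assms by (simp_all only: jacobi[OF X Y] B bracket_field)
  show ?thesis
    using X Y Z W B(1) by (simp add: lie_def j)
qed

lemma lie_combination:
  assumes "X \<in> \<X>" "Y \<in> \<X>" "Z \<in> \<X>" "a \<in> \<F>" "b \<in> \<F>" "B Y Z \<in> \<F>" "C Y Z \<in> \<F>"
  shows "lie X (\<lambda>Y Z. a * B Y Z + b * C Y Z) Y Z =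
    deriv_along X a * B Y Z + a * lie X B Y Z + deriv_along X b * C Y Z + b * lie X C Y Z"
  using assms by (simp add: lie_def algebra_simps)

end

context sasaki_like_manifold
begin

lemma G_biadditive: "smooth_biadditive G"
  and G1_biadditive: "smooth_biadditive (\<lambda>X Y. G1 X Y)"
  and G2_biadditive: "smooth_biadditive (\<lambda>X Y. G2 X Y)"
  by (simp_all add: smooth_biadditive_def G_linear algebra_simps)

lemma lie_xi_G: "X \<in> \<X> \<Longrightarrow> Y \<in> \<X> \<Longrightarrow> lie \<xi> G X Y = - 2 * G2 X Y"
  by (simp add: lie_def deriv_xi_G)

lemma lie_xi_G1: "X \<in> \<X> \<Longrightarrow> Y \<in> \<X> \<Longrightarrow> lie \<xi> (\<lambda>X Y. G1 X Y) X Y = - 2 * G2 X Y"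
  by (simp add: lie_def deriv_xi_G eta_bracket_xi algebra_simps)

lemma lie_xi_G2: "X \<in> \<X> \<Longrightarrow> Y \<in> \<X> \<Longrightarrow> lie \<xi> (\<lambda>X Y. G2 X Y) X Y = 2 * G1 X Y"
  by (simp add: lie_def deriv_xi_G Phi_bracket_xi G_linear algebra_simps)

lemma eta_closed:
  assumes "X \<in> \<X>" "Y \<in> \<X>"
  shows "deriv_along X (eta Y) - deriv_along Y (eta X) = eta (lie_bracket X Y)"
  using assms by (simp add: deriv_eta bracket_eq G2_commute[of Y X])

text \<open>
  Transversally to \<open>\<xi>\<close> the tensors \<open>G1\<close> and \<open>G2\<close> are the real part and minus the
  imaginary part of a holomorphic metric. \<open>tachibana B B'\<close> is the Tachibana operator of \<open>\<phi>\<close>, with \<open>B'\<close> for \<open>B (\<phi> Y) Z\<close>; its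
  vanishing up to a term with \<open>\<eta>\<close> expresses that \<open>B\<close> is holomorphic. It is made of brackets only.
\<close>
definition tachibana ::
  "('a vfield \<Rightarrow> 'a vfield \<Rightarrow> 'a \<Rightarrow> real) \<Rightarrow> ('a vfield \<Rightarrow> 'a vfield \<Rightarrow> 'a \<Rightarrow> real) \<Rightarrow>
    'a vfield \<Rightarrow> 'a vfield \<Rightarrow> 'a vfield \<Rightarrow> 'a \<Rightarrow> real" where
  "tachibana B B' X Y Z = deriv_along (\<Phi> X) (B Y Z) - deriv_along X (B' Y Z)
     + B (lie_bracket Y (\<Phi> X) - \<Phi> (lie_bracket Y X)) Z
     + B Y (lie_bracket Z (\<Phi> X) - \<Phi> (lie_bracket Z X))"

lemma lie_Phi_eq:
  assumes "X \<in> \<X>" "Y \<in> \<X>"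
  shows "lie_bracket Y (\<Phi> X) - \<Phi> (lie_bracket Y X) =
    \<Phi> (D X Y) - D (\<Phi> X) Y - G X Y *\<^sub>V \<xi> - eta X *\<^sub>V Y + (2 * (eta X * eta Y)) *\<^sub>V \<xi>"
  using assms by (simp add: bracket_eq D_Phi G_commute[of Y] mult_ac algebra_simps)

lemma tachibana_G1:
  assumes "X \<in> \<X>" "Y \<in> \<X>" "Z \<in> \<X>"
  shows "tachibana (\<lambda>X Y. G1 X Y) (\<lambda>X Y. G2 X Y) X Y Z = - 2 * eta X * G1 Y Z"
  unfolding tachibana_def lie_Phi_eq[OF assms(1,2)] lie_Phi_eq[OF assms(1,3)]
  using assms by (simp add: deriv_G deriv_eta D_Phi G_linear Phi_self_adjoint algebra_simps)

lemma tachibana_G2: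
  assumes "X \<in> \<X>" "Y \<in> \<X>" "Z \<in> \<X>"
  shows "tachibana (\<lambda>X Y. G2 X Y) (\<lambda>X Y. - G1 X Y) X Y Z = - 2 * eta X * G2 Y Z"
  unfolding tachibana_def lie_Phi_eq[OF assms(1,2)] lie_Phi_eq[OF assms(1,3)]
  using assms by (simp add: deriv_G deriv_eta D_Phi G_linear Phi_self_adjoint algebra_simps)

text \<open>
  The operator is built from \<open>\<phi>\<close>, brackets and derivatives of functions, so a field that preserves \<open>\<phi>\<close>
  acts on it by the Leibniz rule.
\<close>
lemma deriv_tachibana:
  assumes B: "smooth_biadditive B" "smooth_biadditive B'"
    and u: "u \<in> \<X>" "\<And>X. X \<in> \<X> \<Longrightarrow> lie_bracket u (\<Phi> X) = \<Phi> (lie_bracket u X)"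
    and X: "X \<in> \<X>" and Y: "Y \<in> \<X>" and Z: "Z \<in> \<X>"
  shows "deriv_along u (tachibana B B' X Y Z) =
    tachibana (lie u B) (lie u B') X Y Z + tachibana B B' (lie_bracket u X) Y Z
    + tachibana B B' X (lie_bracket u Y) Z + tachibana B B' X Y (lie_bracket u Z)"
proof -
  note B1 = smooth_biadditiveD[OF B(1)] and B2 = smooth_biadditiveD[OF B(2)]
  define S where "S Y X = lie_bracket Y (\<Phi> X) - \<Phi> (lie_bracket Y X)" for X Y
  have S [simp]: "S Y X \<in> \<X>" if "X \<in> \<X>" "Y \<in> \<X>" for X Y
    using that by (simp add: S_def)
  have uS: "lie_bracket u (S Y X) = S (lie_bracket u Y) X + S Y (lie_bracket u X)"
    if "X \<in> \<X>" "Y \<in> \<X>" for X Y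
    using that u by (simp add: S_def bracket_diff jacobi[of u Y])
  have d: "deriv_along u (deriv_along W f) = deriv_along (lie_bracket u W) f + deriv_along W (deriv_along u f)" for W f
    by simp
  have r: "deriv_along u (B Y Z) = lie u B Y Z + B (lie_bracket u Y) Z + B Y (lie_bracket u Z)"
    "deriv_along u (B' Y Z) = lie u B' Y Z + B' (lie_bracket u Y) Z + B' Y (lie_bracket u Z)" for Y Z
    by (simp_all add: lie_def)
  have ls: "lie u B Y Z \<in> \<F>" "lie u B' Y Z \<in> \<F>" if "Y \<in> \<X>" "Z \<in> \<X>" for Y Z
    using that u B1(1) B2(1) by (simp_all add: lie_def)
  have "deriv_along u (tachibana B B' X Y Z) =
      deriv_along u (deriv_along (\<Phi> X) (B Y Z)) - deriv_along u (deriv_along X (B' Y Z))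
      + deriv_along u (B (S Y X) Z) + deriv_along u (B Y (S Z X))"
    using u X Y Z B1(1) B2(1) by (simp add: tachibana_def S_def[symmetric])
  also have "\<dots> = tachibana (lie u B) (lie u B') X Y Z + tachibana B B' (lie_bracket u X) Y Z
    + tachibana B B' X (lie_bracket u Y) Z + tachibana B B' X Y (lie_bracket u Z)"
    unfolding d u(2)[OF X] r
    using u X Y Z B1 B2 ls
    by (simp add: tachibana_def S_def[symmetric] uS algebra_simps del: deriv_vfield(6))
  finally show ?thesis .
qed

text \<open>
  Otherwise the identity would have rank one at \<open>p\<close>: every vector \<open>x\<close> would be \<open>\<eta> (x) \<xi>\<close>, and the trace \<open>2n + 1\<close>
  would be \<open>\<eta> (\<xi>) = 1\<close>.
\<close>
lemma G1_nonzero: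
  assumes "n \<ge> 1"
  obtains Y Z where "Y \<in> \<X>" "Z \<in> \<X>" "G1 Y Z p \<noteq> 0"
proof -
  have "\<not> (\<forall>Y\<in>\<X>. \<forall>Z\<in>\<X>. G1 Y Z p = 0)"
  proof
  assume z: "\<forall>Y\<in>\<X>. \<forall>Z\<in>\<X>. G1 Y Z p = 0"
  obtain E \<theta> s where fr: "cut_off_frame E \<theta> s" and s: "s p \<noteq> 0" by (rule cut_off_frame_exists)
  note frD = cut_off_frameD[OF fr]
  have "E i p = (eta (E i) *\<^sub>V \<xi>) p" for i
  proof -
    let ?X = "E i - eta (E i) *\<^sub>V \<xi>"
    have X: "?X \<in> \<X>" using frD(1) by simp
    have "?X p = 0"
    proof (rule g_nondegenerate[OF field_tangent[OF X]])
      fix w assume "w \<in> tangent_space A p"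
      then obtain W where W: "W \<in> \<X>" "W p = w" by (rule field_through_vector)
      have "G ?X W = G1 (E i) W" using W(1) frD(1) by (simp add: G_linear)
      then have "G ?X W p = 0" using bspec[OF bspec[OF z frD(1)] W(1), of i] by simp
      then show "g p (?X p) w = 0" by (simp only: eval2_def W(2))
    qed
    then show ?thesis by (simp add: minus_apply)
  qed
  then have "eval1 (\<theta> i) (E i) p = eval1 (\<theta> i) (eta (E i) *\<^sub>V \<xi>) p" for i
    by (simp add: eval1_def)
  then have e: "s p = eta (E i) p * eval1 (\<theta> i) \<xi> p" for i
    using frD form_linearD(2)[OF frame_form_linear[OF fr]] by (simp add: fun_apply)
  have "form_linear eta" by (simp add: form_linear_def)
  from fun_cong[OF frame_contraction[OF fr this xi], of p]
  have "(\<Sum>i\<in>UNIV. eta (E i) p * eval1 (\<theta> i) \<xi> p) = s p"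
    by (simp add: fun_apply sum_fun_apply mult.commute)
  then have "real CARD('m) * s p = s p" unfolding e[symmetric] by simp
  then show False using s assms by (simp add: card_m)
  qed
  then show ?thesis using that by blast
qed

end

section \<open>Ricci-like solitons\<close>

locale ricci_like_soliton_manifold = sasaki_like_manifold A \<phi> \<xi> \<eta> g D n
  for A :: "('a::{t2_space, second_countable_topology}, 'm::finite) atlas"
    and \<phi> :: "'a endo_field" and \<xi> :: "'a vfield" and \<eta> :: "'a one_form"
    and g :: "'a bilinear_field" and D :: "'a vfield \<Rightarrow> 'a vfield \<Rightarrow> 'a vfield" and n :: nat +
  fixes v :: "'a vfield" and lam \<mu> \<nu> :: real
  assumes n1: "n \<ge> 1"
    and soliton: "ricci_like_soliton A \<phi> \<eta> g D v lam \<mu> \<nu>"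
begin

text \<open>
  The soliton constants as elements of the ring of functions.
\<close>
definition l :: "'a \<Rightarrow> real" where "l = (\<lambda>_. lam)"
definition m :: "'a \<Rightarrow> real" where "m = (\<lambda>_. \<mu>)"
definition c :: "'a \<Rightarrow> real" where "c = (\<lambda>_. lam + \<mu> + \<nu> + 2 * real n)"

lemma constants [simp]: "l \<in> \<F>" "m \<in> \<F>" "c \<in> \<F>"
  "X \<in> \<X> \<Longrightarrow> deriv_along X l = 0" "X \<in> \<X> \<Longrightarrow> deriv_along X m = 0" "X \<in> \<X> \<Longrightarrow> deriv_along X c = 0"
  by (simp_all add: l_def m_def c_def)

lemma v [simp, intro]: "v \<in> \<X>"
  using soliton unfolding ricci_like_soliton_def by blast

definition w where "w = lie_bracket v \<xi>"
definition f where "f = eta v"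

lemma wf [simp, intro]: "w \<in> \<X>" "f \<in> \<F>"
  by (simp_all add: w_def f_def)

lemma soliton_eq:
  assumes "X \<in> \<X>" "Y \<in> \<X>"
  shows "lie v G X Y = - 2 * (ricci A g D X Y + l * G X Y + m * (G2 X Y + eta X * eta Y) + (\<lambda>_. \<nu>) * (eta X * eta Y))"
proof
  fix p
  have 1: "lie_derivative_bilinear v g X Y = lie v G X Y"
    by (simp add: lie_derivative_bilinear_def lie_def)
  have "eval2 (associated_metric \<phi> \<eta> g) X Y = G X (\<Phi> Y) + eta X * eta Y"
    by (simp add: fun_eq_iff eval2_def eval1_def associated_metric_def endo_apply_def fun_apply)
  then have 2: "eval2 (associated_metric \<phi> \<eta> g) X Y = G2 X Y + eta X * eta Y"
    using assms by (simp add: Phi_self_adjoint)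
  have "1 / 2 * lie_derivative_bilinear v g X Y p + ricci A g D X Y p + lam * G X Y p
      + \<mu> * eval2 (associated_metric \<phi> \<eta> g) X Y p + \<nu> * (eta X p * eta Y p) = 0"
    using soliton assms unfolding ricci_like_soliton_def by blast
  then show "lie v G X Y p = (- 2 * (ricci A g D X Y + l * G X Y + m * (G2 X Y + eta X * eta Y) + (\<lambda>_. \<nu>) * (eta X * eta Y))) p"
    unfolding 1 2 by (simp add: fun_apply l_def m_def)
qed

text \<open>
  The soliton equation expresses \<open>\<rho>\<close> by smooth tensor fields.
\<close>
lemma ricci_smooth: 
  assumes "X \<in> \<X>" "Y \<in> \<X>" shows "ricci A g D X Y \<in> \<F>"
proof -
  have "ricci A g D X Y = - ((\<lambda>_. 1 / 2) * lie v G X Y) -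
      (l * G X Y + m * (G2 X Y + eta X * eta Y) + (\<lambda>_. \<nu>) * (eta X * eta Y))"
    unfolding soliton_eq[OF assms] by (simp add: fun_eq_iff fun_apply field_simps)
  moreover have "lie v G X Y \<in> \<F>" using assms by (simp add: lie_def)
  ultimately show ?thesis using assms by simp
qed

lemma lie_v_G_xi: "X \<in> \<X> \<Longrightarrow> lie v G X \<xi> = - 2 * c * eta X"
  by (simp add: soliton_eq ricci_xi fun_eq_iff fun_apply c_def l_def m_def algebra_simps)

text \<open>
  The form \<open>\<eta>\<close> is closed, so \<open>L\<^sub>v \<eta> = d (\<eta> (v)) = df\<close>; on the other hand \<open>\<eta> = g (_, \<xi>)\<close>, and \<open>L\<^sub>v g\<close> is known on \<open>\<xi>\<close>.
\<close>
lemma G_w: 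
  assumes "X \<in> \<X>" shows "G w X = deriv_along X f + 2 * c * eta X"
proof -
  have "lie v G X \<xi> = deriv_along v (eta X) - eta (lie_bracket v X) - G w X"
    using assms by (simp add: lie_def w_def G_commute[of X])
  also have "deriv_along v (eta X) - eta (lie_bracket v X) = deriv_along X f"
    using eta_closed[of v X] assms by (simp add: f_def algebra_simps)
  finally show ?thesis using assms by (simp add: lie_v_G_xi algebra_simps)
qed

text \<open>
  Both equations result from evaluating \<open>L\<^sub>v \<eta>\<close> at \<open>\<xi>\<close> in two ways.
\<close>
lemma eta_w: "eta w = c" and deriv_xi_f: "deriv_along \<xi> f = - c"
proof -
  have 1: "eta w = deriv_along \<xi> f + 2 * c" using G_w[OF xi] by simp
  have "w = - lie_bracket \<xi> v" unfolding w_def by (rule bracket_antisym)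
  then have 2: "eta w = - deriv_along \<xi> f" by (simp add: eta_bracket_xi f_def)
  have "deriv_along \<xi> f p = - c p" for p
    using fun_cong[OF 1[unfolded 2], of p] by (simp add: fun_apply)
  then show "deriv_along \<xi> f = - c" by (simp add: fun_eq_iff fun_apply)
  with 2 show "eta w = c" by simp
qed

text \<open>
  The form \<open>df + 2 c \<eta>\<close> is closed.
\<close>
lemma D_w_symmetric:
  assumes "X \<in> \<X>" "Y \<in> \<X>"
  shows "G (D X w) Y = G (D Y w) X"
proof -
  have "deriv_along X (G w Y) - deriv_along Y (G w X) =
      deriv_along (lie_bracket X Y) f + 2 * c * (deriv_along X (eta Y) - deriv_along Y (eta X))"
    using assms by (simp add: G_w algebra_simps)
  then have "deriv_along X (G w Y) - deriv_along Y (G w X) = G w (lie_bracket X Y)"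
    using assms by (simp only: eta_closed G_w bracket_field)
  then show ?thesis using assms
    by (simp add: deriv_G bracket_eq G_linear algebra_simps)
qed

lemma D_xi_w: "D \<xi> w = \<Phi> w"
proof -
  have "D \<xi> w - \<Phi> w = 0"
  proof (rule G_nondegenerate)
    fix Y assume Y: "Y \<in> \<X>"
    have "eta (D Y w) = G2 Y w" using deriv_eta[OF Y wf(1)] Y by (simp add: eta_w)
    then show "G (D \<xi> w - \<Phi> w) Y = 0"
      using D_w_symmetric[OF xi Y] Y by (simp add: G_linear G2_commute[of Y])
  qed simp
  then show ?thesis by simp
qed

lemma bracket_xi_w: "lie_bracket \<xi> w = \<Phi> w + \<Phi> w"
  by (simp add: bracket_eq D_xi_w)

text \<open>
  The Lie derivative of the soliton equation along \<open>\<xi>\<close>, where \<open>L\<^sub>\<xi> g = - 2 G2\<close> and \<open>L\<^sub>\<xi> \<rho> = 0\<close>; here \<open>w\<close> enters by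
  the commutator of \<open>L\<^sub>v\<close> and \<open>L\<^sub>\<xi>\<close>.
\<close>
lemma lie_v_G2:
  assumes "X \<in> \<X>" "Y \<in> \<X>"
  shows "2 * lie v (\<lambda>X Y. G2 X Y) X Y = - lie w G X Y - 4 * l * G2 X Y + 4 * m * G1 X Y"
proof -
  have "lie v (lie \<xi> G) X Y = lie \<xi> (lie v G) X Y + lie w G X Y"
    unfolding w_def by (rule lie_commute[OF G_biadditive v xi assms])
  moreover have "lie v (lie \<xi> G) X Y = lie v (\<lambda>X Y. - 2 * G2 X Y) X Y"
    by (rule lie_cong[OF v assms lie_xi_G])
  moreover have "lie v (\<lambda>X Y. - 2 * G2 X Y) X Y = - 2 * lie v (\<lambda>X Y. G2 X Y) X Y"
    using assms by (simp add: lie_def algebra_simps)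
  moreover have "lie \<xi> (lie v G) X Y = 4 * l * G2 X Y - 4 * m * G1 X Y"
  proof -
    have "lie \<xi> (lie v G) X Y = lie \<xi> (\<lambda>X Y. - 2 * (ricci A g D X Y + l * G X Y + m * (G2 X Y + eta X * eta Y) + (\<lambda>_. \<nu>) * (eta X * eta Y))) X Y"
      by (rule lie_cong[OF xi assms soliton_eq])
    also have "\<dots> = - 2 * (l * (- 2 * G2 X Y) + m * (2 * G1 X Y))"
      using assms
      by (simp add: lie_def ricci_smooth lie_xi_ricci deriv_xi_G eta_bracket_xi Phi_bracket_xi G_linear algebra_simps)
    finally show ?thesis by (simp add: algebra_simps)
  qed
  ultimately show ?thesis by (simp add: algebra_simps) 
qed

text \<open>
  The covariant derivative of \<open>w\<close> is symmetric, so \<open>L\<^sub>w g\<close> is twice the Hessian-like form \<open>g (\<nabla>\<^sub>x w, y)\<close>, and applying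
  \<open>\<phi>\<close> twice changes its sign.
\<close>
lemma lie_Phi_w_G2:
  assumes X: "X \<in> \<X>" and Y: "Y \<in> \<X>"
  shows "lie (\<Phi> w) (\<lambda>X Y. G2 X Y) X Y = - lie w G X Y - 2 * c * G2 X Y"
proof -
  have eta_D: "eta (D Z w) = G (\<Phi> w) Z" if "Z \<in> \<X>" for Z
    using deriv_eta[OF that wf(1)] that by (simp add: eta_w G2_commute)
  have s: "G X (D Y w) = G (D X w) Y"
    using D_w_symmetric[OF X Y] X Y by (simp add: G_commute)
  show ?thesis
    using X Y
    by (simp add: lie_def deriv_G bracket_eq D_Phi G_linear Phi_self_adjoint eta_w eta_D s algebra_simps)
qed

definition half :: "'a \<Rightarrow> real" where "half = (\<lambda>_. 1 / 2)"

lemma half [simp]: "half \<in> \<F>" "X \<in> \<X> \<Longrightarrow> deriv_along X half = 0" "2 * (half * b) = b"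
  by (simp_all add: half_def fun_eq_iff fun_apply)

text \<open>
  The first correction makes \<open>\<eta> (u) = 0\<close>, the second one makes \<open>u\<close> commute with \<open>\<xi>\<close> and cancels \<open>L\<^sub>w g\<close>.
\<close>
definition u where "u = v - f *\<^sub>V \<xi> - half *\<^sub>V \<Phi> w"

lemma u [simp, intro]: "u \<in> \<X>"
  by (simp add: u_def)

lemma eta_u: "eta u = 0"
  by (simp add: u_def f_def)

lemma bracket_xi_u: "lie_bracket \<xi> u = 0"
proof -
  have 1: "lie_bracket \<xi> v = - w" unfolding w_def by (rule bracket_antisym)
  have 2: "half *\<^sub>V (X + X) = X" for X
    by (simp add: half_def scale_vfield_def scale_tangent_def fun_eq_iff fun_apply)
  have "lie_bracket \<xi> (\<Phi> w) = \<Phi> (\<Phi> w) + \<Phi> (\<Phi> w)"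
    by (simp only: Phi_bracket_xi wf bracket_xi_w Phi_add Phi_field)
  then have 3: "half *\<^sub>V lie_bracket \<xi> (\<Phi> w) = \<Phi> (\<Phi> w)" by (simp only: 2)
  have "lie_bracket \<xi> u = - w + c *\<^sub>V \<xi> - half *\<^sub>V lie_bracket \<xi> (\<Phi> w)"
    by (simp add: u_def bracket_diff bracket_scale 1 deriv_xi_f vfield_scale_minus bracket_eq[of \<xi> \<xi>])
  then show ?thesis unfolding 3 by (simp add: eta_w)
qed

definition a where "a = 2 * m - 2 * f"

lemma a [simp, intro]: "a \<in> \<F>"
  by (simp add: a_def)

lemma deriv_a: "X \<in> \<X> \<Longrightarrow> deriv_along X a = - 2 * deriv_along X f"
  by (simp add: a_def)

lemma fun_2_cancel: "2 * x = 2 * y \<Longrightarrow> x = (y :: 'a \<Rightarrow> real)"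
  by (simp add: fun_eq_iff fun_apply)

lemma lie_u_G2_with_c:
  assumes X: "X \<in> \<X>" and Y: "Y \<in> \<X>"
  shows "lie u (\<lambda>X Y. G2 X Y) X Y = (c - 2 * l) * G2 X Y + a * G1 X Y"
proof -
  have "lie u (\<lambda>X Y. G2 X Y) X Y = lie v (\<lambda>X Y. G2 X Y) X Y
      - f * lie \<xi> (\<lambda>X Y. G2 X Y) X Y - half * lie (\<Phi> w) (\<lambda>X Y. G2 X Y) X Y"
    using assms by (simp add: u_def lie_def bracket_add bracket_diff bracket_scale G_linear algebra_simps)
  then have "2 * lie u (\<lambda>X Y. G2 X Y) X Y = 2 * lie v (\<lambda>X Y. G2 X Y) X Y
      - 2 * (f * lie \<xi> (\<lambda>X Y. G2 X Y) X Y) - lie (\<Phi> w) (\<lambda>X Y. G2 X Y) X Y"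
    by (simp only: right_diff_distrib half(3))
  also have "\<dots> = 2 * ((c - 2 * l) * G2 X Y + a * G1 X Y)"
    unfolding lie_v_G2[OF assms] lie_Phi_w_G2[OF assms] lie_xi_G2[OF assms]
    by (simp add: a_def algebra_simps)
  finally show ?thesis by (rule fun_2_cancel)
qed

lemma lie_xi_lie_u:
  assumes "smooth_biadditive B" "X \<in> \<X>" "Y \<in> \<X>"
  shows "lie \<xi> (lie u B) X Y = lie u (lie \<xi> B) X Y"
proof -
  have b0: "lie_bracket 0 Z = 0" if "Z \<in> \<X>" for Z
    using that bracket_antisym[of 0 Z] by (simp add: bracket_0)
  have "B 0 Z = 0" "B Z 0 = 0" if "Z \<in> \<X>" for Z
    using smooth_biadditiveD(2,3)[OF assms(1) field_0 field_0 that] by simp_all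
  then have "lie 0 B X Y = 0" using assms by (simp add: lie_def b0)
  then show ?thesis using lie_commute[OF assms(1) xi u assms(2,3)] by (simp add: bracket_xi_u)
qed

lemma lie_scale_form:
  "X \<in> \<X> \<Longrightarrow> Y \<in> \<X> \<Longrightarrow> Z \<in> \<X> \<Longrightarrow> B Y Z \<in> \<F> \<Longrightarrow> r \<in> \<F> \<Longrightarrow> deriv_along X r = 0 \<Longrightarrow>
    lie X (\<lambda>Y Z. r * B Y Z) Y Z = r * lie X B Y Z"
  by (simp add: lie_def algebra_simps)

lemma lie_u_G1_with_c:
  assumes X: "X \<in> \<X>" and Y: "Y \<in> \<X>"
  shows "lie u (\<lambda>X Y. G1 X Y) X Y = (2 * c - 2 * l) * G1 X Y - a * G2 X Y"
proof -
  have "lie u (lie \<xi> (\<lambda>X Y. G2 X Y)) X Y = lie u (\<lambda>X Y. 2 * G1 X Y) X Y"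
    by (rule lie_cong[OF u X Y lie_xi_G2])
  also have "\<dots> = 2 * lie u (\<lambda>X Y. G1 X Y) X Y"
    using assms by (intro lie_scale_form) simp_all
  finally have "2 * lie u (\<lambda>X Y. G1 X Y) X Y = lie \<xi> (lie u (\<lambda>X Y. G2 X Y)) X Y"
    by (simp only: lie_xi_lie_u[OF G2_biadditive assms])
  also have "\<dots> = lie \<xi> (\<lambda>X Y. (c - 2 * l) * G2 X Y + a * G1 X Y) X Y"
    by (rule lie_cong[OF xi X Y lie_u_G2_with_c])
  also have "\<dots> = deriv_along \<xi> (c - 2 * l) * G2 X Y + (c - 2 * l) * lie \<xi> (\<lambda>X Y. G2 X Y) X Y +
      deriv_along \<xi> a * G1 X Y + a * lie \<xi> (\<lambda>X Y. G1 X Y) X Y"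
    using assms by (intro lie_combination) simp_all
  also have "\<dots> = 2 * ((2 * c - 2 * l) * G1 X Y - a * G2 X Y)"
    using assms by (simp add: lie_xi_G1 lie_xi_G2 deriv_a deriv_xi_f algebra_simps)
  finally show ?thesis by (rule fun_2_cancel)
qed

text \<open>
  Since \<open>L\<^sub>\<xi> L\<^sub>\<xi> = - 4\<close> on \<open>G1\<close> and \<open>G2\<close>, a second derivative along \<open>\<xi>\<close> gives \<open>L\<^sub>u G2\<close> again; but the
  coefficient \<open>a\<close> is not constant along \<open>\<xi>\<close> unless \<open>c = 0\<close>, and the two values differ by \<open>2 c G2\<close>.
\<close>
lemma c_zero: "c = 0"
proof
  fix p
  obtain X Y where XY: "X \<in> \<X>" "Y \<in> \<X>" "G1 X Y p \<noteq> 0" by (rule G1_nonzero[OF n1])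
  define Z where "Z = - \<Phi> X"
  have Z: "Z \<in> \<X>" "G2 Z Y = G1 X Y" using XY by (simp_all add: Z_def G_linear)
  have "lie u (lie \<xi> (\<lambda>X Y. G1 X Y)) Z Y = lie u (\<lambda>X Y. - 2 * G2 X Y) Z Y"
    by (rule lie_cong[OF u Z(1) XY(2) lie_xi_G1])
  also have "\<dots> = - 2 * lie u (\<lambda>X Y. G2 X Y) Z Y"
    using Z(1) XY(2) by (intro lie_scale_form) simp_all
  finally have "- 2 * lie u (\<lambda>X Y. G2 X Y) Z Y = lie \<xi> (lie u (\<lambda>X Y. G1 X Y)) Z Y"
    by (simp only: lie_xi_lie_u[OF G1_biadditive Z(1) XY(2)])
  also have "\<dots> = lie \<xi> (\<lambda>X Y. (2 * c - 2 * l) * G1 X Y + (- a) * G2 X Y) Z Y"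
    by (rule lie_cong[OF xi Z(1) XY(2)]) (simp add: lie_u_G1_with_c)
  also have "\<dots> = deriv_along \<xi> (2 * c - 2 * l) * G1 Z Y + (2 * c - 2 * l) * lie \<xi> (\<lambda>X Y. G1 X Y) Z Y +
      deriv_along \<xi> (- a) * G2 Z Y + (- a) * lie \<xi> (\<lambda>X Y. G2 X Y) Z Y"
    using Z(1) XY(2) by (intro lie_combination) simp_all
  finally have "4 * c * G2 Z Y = 0"
    unfolding lie_u_G2_with_c[OF Z(1) XY(2)] lie_xi_G1[OF Z(1) XY(2)] lie_xi_G2[OF Z(1) XY(2)]
    by (simp add: deriv_a deriv_xi_f algebra_simps)
  from fun_cong[OF this, of p] show "c p = 0 p"
    using XY(3) unfolding Z(2) by (simp add: fun_apply)
qed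

lemma lie_u_G2: "X \<in> \<X> \<Longrightarrow> Y \<in> \<X> \<Longrightarrow> lie u (\<lambda>X Y. G2 X Y) X Y = - 2 * l * G2 X Y + a * G1 X Y"
  and lie_u_G1: "X \<in> \<X> \<Longrightarrow> Y \<in> \<X> \<Longrightarrow> lie u (\<lambda>X Y. G1 X Y) X Y = - 2 * l * G1 X Y + (- a) * G2 X Y"
  using lie_u_G2_with_c lie_u_G1_with_c by (simp_all add: c_zero)

lemma u_eta: "X \<in> \<X> \<Longrightarrow> eta (lie_bracket u X) = deriv_along u (eta X)"
  using eta_closed[of u X] by (simp add: eta_u)

text \<open>
  The Lie derivatives of \<open>G1\<close> and \<open>G2\<close> are related by \<open>\<phi>\<close> in the same way as \<open>G1\<close> and \<open>G2\<close> are, so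
  \<open>(L\<^sub>u \<phi>) x\<close> is \<open>G1\<close>-orthogonal to everything; its \<open>\<eta>\<close>-component vanishes because \<open>L\<^sub>u \<eta> = 0\<close>.
\<close>
lemma u_Phi:
  assumes X: "X \<in> \<X>"
  shows "lie_bracket u (\<Phi> X) = \<Phi> (lie_bracket u X)"
proof -
  have "lie_bracket u (\<Phi> X) - \<Phi> (lie_bracket u X) = 0"
  proof (rule G_nondegenerate)
    fix Y assume Y: "Y \<in> \<X>"
    have "lie u (\<lambda>X Y. G1 X Y) (\<Phi> X) Y - lie u (\<lambda>X Y. G2 X Y) X Y =
        G (\<Phi> (lie_bracket u X)) Y - G (lie_bracket u (\<Phi> X)) Y"
      using X Y u_eta[of "\<Phi> X"] by (simp add: lie_def)
    moreover have "lie u (\<lambda>X Y. G1 X Y) (\<Phi> X) Y - lie u (\<lambda>X Y. G2 X Y) X Y = 0"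
      using X Y by (simp add: lie_u_G1 lie_u_G2 G_linear algebra_simps)
    ultimately show "G (lie_bracket u (\<Phi> X) - \<Phi> (lie_bracket u X)) Y = 0"
      using X Y by (simp add: G_linear)
  qed (use X in simp)
  then show ?thesis by simp
qed

text \<open>
  The Lie derivative of \<open>tachibana_G1\<close> along \<open>u\<close>. As \<open>G1\<close> and \<open>G2\<close> are holomorphic already, only the derivatives of
  the coefficient \<open>a\<close> survive. The equation says that \<open>a\<close> is the imaginary part of a holomorphic function with constant real part.
\<close>
lemma a_holomorphic:
  assumes X: "X \<in> \<X>" and Y: "Y \<in> \<X>" and Z: "Z \<in> \<X>"
  shows "deriv_along (\<Phi> X) a * G2 Y Z + deriv_along X a * G1 Y Z = 0"
proof -
  let ?G1 = "\<lambda>X Y. G1 X Y" and ?G2 = "\<lambda>X Y. G2 X Y" and ?b = "lie_bracket u"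
  let ?K1 = "\<lambda>X Y. - 2 * l * G1 X Y + (- a) * G2 X Y" and ?K2 = "\<lambda>X Y. - 2 * l * G2 X Y + a * G1 X Y"
  have S: "lie_bracket Y (\<Phi> X) - \<Phi> (lie_bracket Y X) \<in> \<X>" "lie_bracket Z (\<Phi> X) - \<Phi> (lie_bracket Z X) \<in> \<X>"
    using X Y Z by simp_all
  have "tachibana (lie u ?G1) (lie u ?G2) X Y Z = tachibana ?K1 ?K2 X Y Z"
    using X Y Z S by (simp only: tachibana_def lie_u_G1 lie_u_G2)
  also have "\<dots> = - 2 * l * tachibana ?G1 ?G2 X Y Z - a * tachibana ?G2 (\<lambda>X Y. - G1 X Y) X Y Z
      - deriv_along (\<Phi> X) a * G2 Y Z - deriv_along X a * G1 Y Z"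
    using X Y Z by (simp add: tachibana_def algebra_simps)
  also have "\<dots> = 4 * (l * (eta X * G1 Y Z)) + 2 * (a * (eta X * G2 Y Z))
      - deriv_along (\<Phi> X) a * G2 Y Z - deriv_along X a * G1 Y Z"
    unfolding tachibana_G1[OF assms] tachibana_G2[OF assms] by (simp add: algebra_simps)
  finally have 1: "tachibana (lie u ?G1) (lie u ?G2) X Y Z = \<dots>" .
  have 2: "deriv_along u (tachibana ?G1 ?G2 X Y Z) =
      tachibana (lie u ?G1) (lie u ?G2) X Y Z + tachibana ?G1 ?G2 (?b X) Y Z
      + tachibana ?G1 ?G2 X (?b Y) Z + tachibana ?G1 ?G2 X Y (?b Z)"
    by (rule deriv_tachibana[OF G1_biadditive G2_biadditive u u_Phi X Y Z])
  have du: "deriv_along u (G1 Y Z) = G1 (?b Y) Z + G1 Y (?b Z) - 2 * l * G1 Y Z - a * G2 Y Z"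
    using lie_u_G1[OF Y Z] by (simp add: lie_def algebra_simps)
  have "deriv_along u (- 2 * eta X * G1 Y Z) =
      - 2 * (deriv_along u (eta X) * G1 Y Z + eta X * deriv_along u (G1 Y Z))"
    using X Y Z by (simp add: algebra_simps)
  then have 3: "deriv_along u (tachibana ?G1 ?G2 X Y Z) =
      - 2 * (eta (?b X) * G1 Y Z + eta X * (G1 (?b Y) Z + G1 Y (?b Z) - 2 * l * G1 Y Z - a * G2 Y Z))"
    unfolding tachibana_G1[OF assms] du by (simp only: u_eta[OF X])
  have 4: "tachibana ?G1 ?G2 (?b X) Y Z = - 2 * eta (?b X) * G1 Y Z"
    "tachibana ?G1 ?G2 X (?b Y) Z = - 2 * eta X * G1 (?b Y) Z"
    "tachibana ?G1 ?G2 X Y (?b Z) = - 2 * eta X * G1 Y (?b Z)"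
    using X Y Z by (simp_all only: tachibana_G1 bracket_field u)
  show ?thesis using 2[unfolded 1 3 4] by (simp add: algebra_simps)
qed

text \<open>
  The equations of \<open>a_holomorphic\<close> for \<open>y\<close> and \<open>\<phi> y\<close> are a linear system for \<open>x a\<close> and \<open>(\<phi> x) a\<close> with
  determinant \<open>- (G1 (y, z)^2 + G2 (y, z)^2)\<close>.
\<close>
lemma a_constant:
  assumes X: "X \<in> \<X>" shows "deriv_along X a = 0"
proof
  fix p
  obtain Y Z where YZ: "Y \<in> \<X>" "Z \<in> \<X>" "G1 Y Z p \<noteq> 0" by (rule G1_nonzero[OF n1])
  define r t where "r = deriv_along X a p" and "t = deriv_along (\<Phi> X) a p"
  have 1: "t * G2 Y Z p + r * G1 Y Z p = 0"
    using fun_cong[OF a_holomorphic[OF X YZ(1,2)], of p] by (simp add: fun_apply r_def t_def)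
  have 2: "r * G2 Y Z p - t * G1 Y Z p = 0"
    using fun_cong[OF a_holomorphic[OF X Phi_field[OF YZ(1)] YZ(2)], of p] YZ(1,2)
    by (simp add: fun_apply r_def t_def G_linear algebra_simps)
  have "(r\<^sup>2 + t\<^sup>2) * G1 Y Z p = r * (t * G2 Y Z p + r * G1 Y Z p) - t * (r * G2 Y Z p - t * G1 Y Z p)"
    by (simp add: algebra_simps power2_eq_square)
  then have "r\<^sup>2 + t\<^sup>2 = 0" using YZ(3) by (simp only: 1 2) simp
  then show "deriv_along X a p = 0 p" by (simp add: r_def fun_apply)
qed

lemma w_zero: "w = 0"
proof (rule G_nondegenerate)
  fix X assume X: "X \<in> \<X>"
  have "2 * deriv_along X f = 2 * 0" using a_constant[OF X] by (simp add: deriv_a X)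
  then have "deriv_along X f = 0" by (rule fun_2_cancel)
  then show "G w X = 0" using G_w[OF X] by (simp add: c_zero)
qed simp

lemma soliton_constants: "lam + \<mu> + \<nu> = - 2 * real n"
  using fun_cong[OF c_zero, of undefined] by (simp add: c_def fun_apply)

lemma D_xi_v: "D \<xi> v = - \<Phi> v"
proof -
  have "D v \<xi> - D \<xi> v = 0" using w_zero by (simp add: w_def bracket_eq)
  then show ?thesis by simp
qed

end

theorem theorem3p1:
  fixes A :: "('a::{t2_space, second_countable_topology}, 'm::finite) atlas"
    and \<phi> :: "'a endo_field" and \<xi> :: "'a vfield" and \<eta> :: "'a one_form"
    and g :: "'a bilinear_field" and D :: "'a vfield \<Rightarrow> 'a vfield \<Rightarrow> 'a vfield"
    and v :: "'a vfield" and lam \<mu> \<nu> :: real and n :: nat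
  assumes "n \<ge> 1"
    and "almost_contact_B_metric n A \<phi> \<xi> \<eta> g"
    and "levi_civita_connection A g D"
    and "sasaki_like A \<phi> \<xi> \<eta> g D"
    and "ricci_like_soliton A \<phi> \<eta> g D v lam \<mu> \<nu>"
  shows "lam + \<mu> + \<nu> = - 2 * real n \<and> D \<xi> v = - endo_apply \<phi> v"
proof -
  interpret ricci_like_soliton_manifold A \<phi> \<xi> \<eta> g D n v lam \<mu> \<nu>
    using assms by unfold_locales
  show ?thesis using soliton_constants D_xi_v by simp
qed

end
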